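(* Let $F$ be a non-Archimedean local field of characteristic zero. For any irreducible smooth representation $\pi$ of $\mathrm{GL}_n(F)$, the $\pi$-kernel function $$k_{\pi,\psi}(x):=\lim_{\ell\to\infty}\int_{\det g=x}(\Phi_{\mathrm{GJ}}*\mathfrak{c}_\ell^\vee)(g)\,\varphi_{\widetilde\pi}(g)\,d_xg$$ is a smooth function on $F^\times$.
   Context: $\mathfrak{o}_F$ is the ring of integers of $F$, $\mathfrak{p}$ its maximal ideal, $\varpi$ a uniformizer, $|\cdot|_F$ the normalized absolute value. $\psi$ is an additive character of $F$ trivial on $\mathfrak{o}_F$ and non-trivial on $\varpi^{-1}\mathfrak{o}_F$. $d^+g$ is the measure on $\mathrm{M}_n(F)$ induced by the self-dual Haar measure on $F$ for $\psi$, and $dg=|\det g|_F^{-n}d^+g$ on $\mathrm{GL}_n(F)$. For $x\in F^\times$, $d_xg$ is the $\mathrm{SL}_n(F)$-invariant measure on the $\mathrm{SL}_n(F)$-torsor $\{g\in\mathrm{GL}_n(F):\det g=x\}$ induced from the Haar measure of $\mathrm{SL}_n(F)$. Put $f^\vee(g)=f(g^{-1})$ and $(f_1*f_2)(g)=\int_{\mathrm{GL}_n(F)}f_1(h)f_2(h^{-1}g)\,dh$. $\Phi_{\mathrm{GJ}}(g)=\psi(\mathrm{tr}\,g)|\det g|_F^{n/2}$ on $\mathrm{GL}_n(F)$; $K_\ell=\mathrm{I}_n+\mathrm{M}_n(\mathfrak{p}^\ell)$ and $\mathfrak{c}_\ell=\mathrm{vol}(K_\ell)^{-1}\mathbf{1}_{K_\ell}$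 for $\ell\ge1$. $\varphi_{\widetilde\pi}$ is a fixed matrix coefficient of the contragredient $\widetilde\pi$ with $\varphi_{\widetilde\pi}(\mathrm{I}_n)=1$. Smooth means locally constant. *)

theory Defs
  imports "HOL-Analysis.Analysis" "HOL-Library.Function_Algebras"
begin

section \<open>Non-Archimedean local fields\<close>

text \<open>
  A non-Archimedean local field is presented with its normalized absolute value: a nontrivial
  ultrametric absolute value whose unit ball is compact, and which takes the value \<open>1/q\<close> on
  uniformizers, where \<open>q\<close> is the cardinality of the residue field.
  The characteristic is not restricted here.
\<close>

class nonarch_local_field = field + metric_space +
  fixes absF :: "'a \<Rightarrow> real"
  assumes dist_absF: "dist x y = absF (x - y)"
    and absF_mult: "absF (x * y) = absF x * absF y"
    and absF_ultrametric: "absF (x + y) \<le> max (absF x) (absF y)"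
    and absF_nontrivial: "\<exists>x. x \<noteq> 0 \<and> absF x \<noteq> 1"
    and compact_integers: "compact {x. absF x \<le> 1}"
    and absF_normalized:
      "{x. absF x < 1} = (\<lambda>y. w * y) ` {y. absF y \<le> 1} \<Longrightarrow>
        absF w = 1 / real (card ({x. absF x \<le> 1} //
          {(x, y). absF x \<le> 1 \<and> absF y \<le> 1 \<and> absF (x - y) < 1}))"

definition integers :: "'F::nonarch_local_field set" where
  "integers = {x. absF x \<le> 1}"

definition max_ideal :: "'F::nonarch_local_field set" where
  "max_ideal = {x. absF x < 1}"

definition uniformizer :: "'F::nonarch_local_field \<Rightarrow> bool" where
  "uniformizer w \<longleftrightarrow> max_ideal = (\<lambda>y. w * y) ` integers"

definition ideal_pow :: "'F::nonarch_local_field \<Rightarrow> nat \<Rightarrow> 'F set" where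
  "ideal_pow w l = (\<lambda>y. w ^ l * y) ` integers"

definition additive_character :: "('F::nonarch_local_field \<Rightarrow> complex) \<Rightarrow> bool" where
  "additive_character \<psi> \<longleftrightarrow>
     continuous_on UNIV \<psi> \<and> (\<forall>x. norm (\<psi> x) = 1) \<and> (\<forall>x y. \<psi> (x + y) = \<psi> x * \<psi> y)"

text \<open>Smooth means locally constant, for the subspace topology of \<open>S\<close>.\<close>

definition smooth_on :: "'a::topological_space set \<Rightarrow> ('a \<Rightarrow> 'b) \<Rightarrow> bool" where
  "smooth_on S f \<longleftrightarrow> (\<forall>x\<in>S. \<exists>U. open U \<and> x \<in> U \<and> f constant_on (U \<inter> S))"


section \<open>Haar measures\<close>

text \<open>
  Left Haar measures on a subset \<open>G\<close> that is a group under \<open>op\<close>. All groups below are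
  second countable and locally compact, so that regularity is automatic.
\<close>

definition haar_measure_on ::
    "'g::topological_space set \<Rightarrow> ('g \<Rightarrow> 'g \<Rightarrow> 'g) \<Rightarrow> 'g measure \<Rightarrow> bool" where
  "haar_measure_on G op \<mu> \<longleftrightarrow>
     space \<mu> = G \<and> sets \<mu> = sets (restrict_space borel G) \<and>
     (\<forall>a\<in>G. distr \<mu> \<mu> (op a) = \<mu>) \<and>
     (\<forall>K\<subseteq>G. compact K \<longrightarrow> emeasure \<mu> K < \<infinity>) \<and>
     (\<forall>U. open U \<longrightarrow> U \<inter> G \<noteq> {} \<longrightarrow> emeasure \<mu> (U \<inter> G) > 0)"

definition fourier ::
    "('F::nonarch_local_field \<Rightarrow> complex) \<Rightarrow> 'F measure \<Rightarrow> ('F \<Rightarrow> complex) \<Rightarrow> 'F \<Rightarrow> complex" where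
  "fourier \<psi> \<mu> f y = (LINT z|\<mu>. f z * \<psi> (z * y))"

text \<open>Self-duality is Fourier inversion on the Schwartz--Bruhat space of \<open>F\<close>.\<close>

definition self_dual_haar ::
    "('F::nonarch_local_field \<Rightarrow> complex) \<Rightarrow> 'F measure \<Rightarrow> bool" where
  "self_dual_haar \<psi> \<mu> \<longleftrightarrow> haar_measure_on UNIV (+) \<mu> \<and>
     (\<forall>f. smooth_on UNIV f \<and> compact (closure {x. f x \<noteq> 0}) \<longrightarrow>
        (\<forall>x. fourier \<psi> \<mu> (fourier \<psi> \<mu> f) x = f (- x)))"


section \<open>\<open>GL\<^sub>n\<close>, \<open>SL\<^sub>n\<close> and the measures on them\<close>

definition GL :: "('F::nonarch_local_field ^ 'n ^ 'n) set" where
  "GL = {g. invertible g}"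

definition SL :: "('F::nonarch_local_field ^ 'n ^ 'n) set" where
  "SL = {g. det g = 1}"

definition mat_measure ::
    "'F::nonarch_local_field measure \<Rightarrow> ('F ^ 'n ^ 'n) measure" where
  "mat_measure \<mu> =
     distr (\<Pi>\<^sub>M p\<in>(UNIV :: ('n \<times> 'n) set). \<mu>) borel (\<lambda>f. \<chi> i j. f (i, j))"

definition GL_measure ::
    "'F::nonarch_local_field measure \<Rightarrow> ('F ^ 'n ^ 'n) measure" where
  "GL_measure \<mu> = density (restrict_space (mat_measure \<mu>) GL)
     (\<lambda>g. ennreal (1 / absF (det g) ^ CARD('n)))"

definition det_section :: "'F::nonarch_local_field \<Rightarrow> 'F ^ 'n ^ 'n" where
  "det_section x = (\<chi> i j. if i = j then (if i = (SOME k. True) then x else 1) else 0)"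

text \<open>
  The measure \<open>d\<^sub>xg\<close>: the Haar measure \<open>\<nu>\<close> of \<open>SL\<^sub>n\<close> transported to the fibre of \<open>det\<close> over \<open>x\<close>
  along the orbit map of a base point of determinant \<open>x\<close>. As \<open>SL\<^sub>n\<close> is unimodular, the result does
  not depend on the base point; we take \<open>diag(x,1,...,1)\<close>.
\<close>

definition fibre_measure ::
    "('F::nonarch_local_field ^ 'n ^ 'n) measure \<Rightarrow> 'F \<Rightarrow> ('F ^ 'n ^ 'n) measure" where
  "fibre_measure \<nu> x =
     distr \<nu> (restrict_space borel {g. det g = x}) (\<lambda>h. h ** det_section x)"


section \<open>Smooth representations of \<open>GL\<^sub>n(F)\<close>\<close>

text \<open>
  The representation space is a subspace \<open>V\<close> of an ambient complex vector space, so that the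
  contragredient (on a space of functionals) is an instance of the same notions.
\<close>

locale GL_representation = vector_space sc
  for sc :: "complex \<Rightarrow> 'v::ab_group_add \<Rightarrow> 'v" +
  fixes V :: "'v set"
    and \<pi> :: "'F::nonarch_local_field ^ 'n ^ 'n \<Rightarrow> 'v \<Rightarrow> 'v"
  assumes subspace_V: "subspace V"
    and maps: "g \<in> GL \<Longrightarrow> v \<in> V \<Longrightarrow> \<pi> g v \<in> V"
    and map_add: "g \<in> GL \<Longrightarrow> v \<in> V \<Longrightarrow> w \<in> V \<Longrightarrow> \<pi> g (v + w) = \<pi> g v + \<pi> g w"
    and map_scale: "g \<in> GL \<Longrightarrow> v \<in> V \<Longrightarrow> \<pi> g (sc c v) = sc c (\<pi> g v)"
    and map_one: "v \<in> V \<Longrightarrow> \<pi> (mat 1) v = v"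
    and map_mult: "g \<in> GL \<Longrightarrow> h \<in> GL \<Longrightarrow> v \<in> V \<Longrightarrow> \<pi> (g ** h) v = \<pi> g (\<pi> h v)"

locale smooth_GL_representation = GL_representation +
  assumes open_stabilizer: "v \<in> V \<Longrightarrow> open {g \<in> GL. \<pi> g v = v}"

locale irreducible_smooth_GL_representation = smooth_GL_representation +
  assumes nonzero: "V \<noteq> {0}"
    and irreducible: "subspace W \<Longrightarrow> W \<subseteq> V \<Longrightarrow> (\<And>g w. g \<in> GL \<Longrightarrow> w \<in> W \<Longrightarrow> \<pi> g w \<in> W) \<Longrightarrow>
      W = {0} \<or> W = V"

text \<open>
  A functional on \<open>V\<close> is represented by its extension by zero to the ambient type.
\<close>

definition dual_action ::
    "'v set \<Rightarrow> ('F::nonarch_local_field ^ 'n ^ 'n \<Rightarrow> 'v \<Rightarrow> 'v) \<Rightarrow>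
      'F ^ 'n ^ 'n \<Rightarrow> ('v \<Rightarrow> complex) \<Rightarrow> 'v \<Rightarrow> complex" where
  "dual_action V \<pi> g f = (\<lambda>v. if v \<in> V then f (\<pi> (matrix_inv g) v) else 0)"

definition smooth_dual ::
    "(complex \<Rightarrow> 'v::ab_group_add \<Rightarrow> 'v) \<Rightarrow> 'v set \<Rightarrow>
      ('F::nonarch_local_field ^ 'n ^ 'n \<Rightarrow> 'v \<Rightarrow> 'v) \<Rightarrow> ('v \<Rightarrow> complex) set" where
  "smooth_dual sc V \<pi> = {f.
     (\<forall>v\<in>V. \<forall>w\<in>V. f (v + w) = f v + f w) \<and> (\<forall>c. \<forall>v\<in>V. f (sc c v) = c * f v) \<and>
     (\<forall>v. v \<notin> V \<longrightarrow> f v = 0) \<and> open {g \<in> GL. dual_action V \<pi> g f = f}}"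

definition fun_scale :: "complex \<Rightarrow> ('v \<Rightarrow> complex) \<Rightarrow> 'v \<Rightarrow> complex" where
  "fun_scale c f = (\<lambda>v. c * f v)"

definition matrix_coefficient ::
    "(complex \<Rightarrow> 'v::ab_group_add \<Rightarrow> 'v) \<Rightarrow> 'v set \<Rightarrow>
      ('F::nonarch_local_field ^ 'n ^ 'n \<Rightarrow> 'v \<Rightarrow> 'v) \<Rightarrow> ('F ^ 'n ^ 'n \<Rightarrow> complex) \<Rightarrow> bool" where
  "matrix_coefficient sc V \<pi> \<phi> \<longleftrightarrow>
     (\<exists>v\<in>V. \<exists>f\<in>smooth_dual sc V \<pi>. \<forall>g\<in>GL. \<phi> g = f (\<pi> g v))"

definition contragredient_coefficient ::
    "(complex \<Rightarrow> 'v::ab_group_add \<Rightarrow> 'v) \<Rightarrow> 'v set \<Rightarrow>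
      ('F::nonarch_local_field ^ 'n ^ 'n \<Rightarrow> 'v \<Rightarrow> 'v) \<Rightarrow> ('F ^ 'n ^ 'n \<Rightarrow> complex) \<Rightarrow> bool" where
  "contragredient_coefficient sc V \<pi> \<phi> \<longleftrightarrow>
     matrix_coefficient fun_scale (smooth_dual sc V \<pi>) (dual_action V \<pi>) \<phi>"


section \<open>The kernel function\<close>

definition Phi_GJ ::
    "('F::nonarch_local_field \<Rightarrow> complex) \<Rightarrow> 'F ^ 'n ^ 'n \<Rightarrow> complex" where
  "Phi_GJ \<psi> g = \<psi> (trace g) * of_real (absF (det g) powr (real CARD('n) / 2))"

definition congruence_subgroup ::
    "'F::nonarch_local_field \<Rightarrow> nat \<Rightarrow> ('F ^ 'n ^ 'n) set" where
  "congruence_subgroup w l = {mat 1 + m |m. \<forall>i j. m $ i $ j \<in> ideal_pow w l}"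

definition c_fun ::
    "'F::nonarch_local_field measure \<Rightarrow> 'F \<Rightarrow> nat \<Rightarrow> 'F ^ 'n ^ 'n \<Rightarrow> complex" where
  "c_fun \<mu> w l g =
     of_real (indicator (congruence_subgroup w l) g /
       measure (GL_measure \<mu>) (congruence_subgroup w l :: ('F ^ 'n ^ 'n) set))"

definition inv_pullback :: "('F::nonarch_local_field ^ 'n ^ 'n \<Rightarrow> complex) \<Rightarrow> 'F ^ 'n ^ 'n \<Rightarrow> complex" where
  "inv_pullback f g = f (matrix_inv g)"

definition convolution ::
    "'F::nonarch_local_field measure \<Rightarrow> ('F ^ 'n ^ 'n \<Rightarrow> complex) \<Rightarrow> ('F ^ 'n ^ 'n \<Rightarrow> complex) \<Rightarrow>
      'F ^ 'n ^ 'n \<Rightarrow> complex" where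
  "convolution \<mu> f1 f2 g = (LINT h|GL_measure \<mu>. f1 h * f2 (matrix_inv h ** g))"

definition kernel_integrand ::
    "('F::nonarch_local_field \<Rightarrow> complex) \<Rightarrow> 'F measure \<Rightarrow> 'F \<Rightarrow> ('F ^ 'n ^ 'n \<Rightarrow> complex) \<Rightarrow>
      nat \<Rightarrow> 'F ^ 'n ^ 'n \<Rightarrow> complex" where
  "kernel_integrand \<psi> \<mu> w \<phi> l g =
     convolution \<mu> (Phi_GJ \<psi>) (inv_pullback (c_fun \<mu> w l)) g * \<phi> g"

definition kernel_seq ::
    "('F::nonarch_local_field \<Rightarrow> complex) \<Rightarrow> 'F measure \<Rightarrow> ('F ^ 'n ^ 'n) measure \<Rightarrow> 'F \<Rightarrow>
      ('F ^ 'n ^ 'n \<Rightarrow> complex) \<Rightarrow> 'F \<Rightarrow> nat \<Rightarrow> complex" where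
  "kernel_seq \<psi> \<mu> \<nu> w \<phi> x l = (LINT g|fibre_measure \<nu> x. kernel_integrand \<psi> \<mu> w \<phi> l g)"

definition pi_kernel ::
    "('F::nonarch_local_field \<Rightarrow> complex) \<Rightarrow> 'F measure \<Rightarrow> ('F ^ 'n ^ 'n) measure \<Rightarrow> 'F \<Rightarrow>
      ('F ^ 'n ^ 'n \<Rightarrow> complex) \<Rightarrow> 'F \<Rightarrow> complex" where
  "pi_kernel \<psi> \<mu> \<nu> w \<phi> x = lim (kernel_seq \<psi> \<mu> \<nu> w \<phi> x)"

end

theory Submission
  imports Defs
begin

text \<open>
  Write \<open>q\<close> for the inverse of the absolute value of the uniformizer, \<open>\<bar>g\<bar>\<close> for the largest absolute
  value of an entry of \<open>g\<close>, and \<open>K\<^sub>l\<close> for the congruence subgroup \<open>\<bar>k - 1\<bar> \<le> q\<^sup>-\<^sup>l\<close>. The kernel function is the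
  limit of the integrals of \<open>(\<Phi> * c\<^sub>l\<^sup>\<or>) \<phi>\<close> over the fibres of the determinant.

  The convolution averages \<open>\<Phi>\<close> over \<open>g K\<^sub>l = g + g M\<^sub>n(\<pp>\<^sup>l)\<close>, and on this coset \<open>\<psi> \<circ> trace\<close> is a
  character of a lattice. By orthogonality the average vanishes unless this character is trivial,
  that is, unless \<open>\<bar>g\<bar> \<le> q\<^sup>l\<close>; in that case it equals \<open>\<psi>(trace g)\<close> times a positive weight which does not
  depend on \<open>l\<close> and is invariant under \<open>K\<^sub>1\<close> on both sides (\<open>convolution_eq\<close>). The coefficient \<open>\<phi>\<close> is
  invariant under some \<open>K\<^sub>m\<close> on both sides (\<open>contragredient_coefficient_biinvariant\<close>). So the
  integrals in question are
    \<open>J\<^sub>l(x) = \<integral> \<psi>(trace g) H(g) d\<^sub>xg\<close>, taken over \<open>det g = x\<close> and \<open>\<bar>g\<bar> \<le> q\<^sup>l\<close>,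
  with \<open>H\<close> bi-invariant under \<open>K\<^sub>m\<close>. The domain is compact and the integrand locally constant.

  The sequence \<open>J\<^sub>l(x)\<close> is eventually constant. Indeed \<open>J\<^sub>L\<^sub>+\<^sub>1(x) - J\<^sub>L(x)\<close> is an integral over the annulus
  \<open>\<bar>g\<bar> = q\<^sup>L\<^sup>+\<^sup>1\<close>, which splits into finitely many balls of radius \<open>q\<^sup>L\<close>; all \<open>g\<close> in one ball have the same
  leading term. Left multiplication by \<open>k \<in> K\<^sub>L\<close> of determinant 1 preserves each ball, the measure and
  \<open>H\<close>, and if the leading term is not scalar then some such \<open>k\<close> multiplies \<open>\<psi>(trace g)\<close> by a constant
  different from 1, so the integral over the ball is 0. If the leading term is scalar, then
  \<open>\<bar>det g\<bar> = q\<^sup>n\<^sup>(\<^sup>L\<^sup>+\<^sup>1\<^sup>)\<close>, which differs from \<open>\<bar>x\<bar>\<close> once \<open>L\<close> is large, and the ball does not meet the fibre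
  (\<open>multiplier_or_det\<close>, \<open>truncated_integral_stable\<close>). The bound on \<open>L\<close> depends on \<open>x\<close> only through \<open>\<bar>x\<bar>\<close>.

  Finally each \<open>J\<^sub>l\<close> is locally constant: the fibre over \<open>x u\<close> is the fibre over \<open>x\<close> multiplied on the
  right by \<open>diag(u,1,\<dots>,1)\<close>, and for \<open>u\<close> close to 1 this matrix lies in \<open>K\<^sub>m \<inter> K\<^sub>l\<close> and does not change the
  integrand (\<open>truncated_integral_locally_constant\<close>). As the index at which the sequence becomes
  constant is locally uniform in \<open>x\<close>, the limit is locally constant too.
\<close>

section \<open>The absolute value of a non-Archimedean local field\<close>

lemma absF_eq_dist: "absF (x::'F::nonarch_local_field) = dist x 0"
  by (simp add: dist_absF)

lemma absF_nonneg [simp]: "0 \<le> absF (x::'F::nonarch_local_field)"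
  by (simp add: absF_eq_dist)

lemma absF_eq_0_iff [simp]: "absF (x::'F::nonarch_local_field) = 0 \<longleftrightarrow> x = 0"
  by (simp add: absF_eq_dist)

lemma absF_0 [simp]: "absF (0::'F::nonarch_local_field) = 0"
  by simp

lemma absF_pos_iff [simp]: "0 < absF (x::'F::nonarch_local_field) \<longleftrightarrow> x \<noteq> 0"
  by (simp add: absF_eq_dist)

lemma absF_1 [simp]: "absF (1::'F::nonarch_local_field) = 1"
  using absF_mult[of "1::'F" 1] by simp

lemma absF_minus [simp]: "absF (- x) = absF (x::'F::nonarch_local_field)"
  using dist_absF[of 0 x] dist_commute[of 0 x] absF_eq_dist[of x] by simp

lemma absF_diff: "absF (x - y) \<le> max (absF x) (absF (y::'F::nonarch_local_field))"
  using absF_ultrametric[of x "- y"] by simp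

lemma absF_power: "absF (x ^ k) = absF (x::'F::nonarch_local_field) ^ k"
  by (induction k) (simp_all add: absF_mult)

lemma absF_inverse: "absF (inverse x) = inverse (absF (x::'F::nonarch_local_field))"
proof (cases "x = 0")
  case False
  have "absF x * absF (inverse x) = 1"
    using False by (simp flip: absF_mult)
  then show ?thesis using False by (metis inverse_unique)
qed simp

lemma absF_divide: "absF (x / y) = absF x / absF (y::'F::nonarch_local_field)"
  by (simp add: divide_inverse absF_mult absF_inverse)

lemma absF_prod: "absF (\<Prod>i\<in>I. f i) = (\<Prod>i\<in>I. absF (f i :: 'F::nonarch_local_field))"
  by (induction I rule: infinite_finite_induct) (simp_all add: absF_mult)

lemma absF_sum_le:
  assumes "\<And>i. i \<in> I \<Longrightarrow> absF (f i :: 'F::nonarch_local_field) \<le> r" and "0 \<le> r"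
  shows "absF (\<Sum>i\<in>I. f i) \<le> r"
  using assms
proof (induction I rule: infinite_finite_induct)
  case (insert i I)
  have "absF (f i + (\<Sum>i\<in>I. f i)) \<le> max (absF (f i)) (absF (\<Sum>i\<in>I. f i))"
    by (rule absF_ultrametric)
  also have "\<dots> \<le> r" using insert by simp
  finally show ?case using insert by simp
qed simp_all

lemma absF_add_eq:
  fixes x y :: "'F::nonarch_local_field"
  assumes "absF y < absF x"
  shows "absF (x + y) = absF x"
proof -
  have "absF x \<le> max (absF (x + y)) (absF y)"
    using absF_diff[of "x + y" y] by simp
  then show ?thesis using assms absF_ultrametric[of x y] by auto
qed

lemma uniformizer_absF:
  assumes "uniformizer (w::'F::nonarch_local_field)"
  shows "0 < absF w" "absF w < 1" "w \<noteq> 0"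
proof -
  have m: "{x::'F. absF x < 1} = (\<lambda>y. w * y) ` {x. absF x \<le> 1}"
    using assms by (simp add: uniformizer_def max_ideal_def integers_def)
  have "w * 1 \<in> (\<lambda>y. w * y) ` {x. absF x \<le> 1}" by (rule imageI) simp
  then have "w \<in> {x. absF x < 1}" by (subst m) simp
  then show "absF w < 1" by simp
  show w0: "w \<noteq> 0"
  proof
    assume "w = 0"
    then have z: "x = 0" if "absF x < 1" for x :: 'F using m that by auto
    obtain x :: 'F where "x \<noteq> 0" "absF x \<noteq> 1" using absF_nontrivial by blast
    then have "absF x > 1" using z[of x] by force
    then have "absF (inverse x) < 1" by (simp add: absF_inverse inverse_less_1_iff)
    then show False using z[of "inverse x"] \<open>x \<noteq> 0\<close> by simp
  qed
  then show "0 < absF w" by simp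
qed

lemma uniformizer_gap:
  fixes w y :: "'F::nonarch_local_field"
  assumes "uniformizer w" and "absF y < 1"
  shows "absF y \<le> absF w"
proof -
  have "y \<in> max_ideal" using assms(2) by (simp add: max_ideal_def)
  then obtain z where "y = w * z" "absF z \<le> 1"
    using assms(1) by (auto simp: uniformizer_def integers_def)
  then show ?thesis by (simp add: absF_mult mult_left_le)
qed

text \<open>
  Scaling by a power of the uniformizer reduces this to the fact that \<open>absF w\<close> is the largest absolute
  value below 1.
\<close>

lemma absF_gap:
  fixes w y :: "'F::nonarch_local_field"
  assumes w: "uniformizer w" and y: "absF y > inverse (absF w) ^ l"
  shows "absF y \<ge> inverse (absF w) ^ Suc l"
proof -
  note wp = uniformizer_absF[OF w]
  have pos: "0 < absF w ^ l" using wp by simp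
  have "0 < inverse (absF w) ^ l" using wp by simp
  then have y0: "0 < absF y" using y by linarith
  have "1 < absF w ^ l * absF y"
    using mult_strict_left_mono[OF y pos] wp by (simp add: power_inverse)
  then have "inverse (absF w ^ l * absF y) < 1" by (subst inverse_less_1_iff) simp
  then have "absF (inverse (w ^ l * y)) < 1" by (simp add: absF_inverse absF_mult absF_power)
  from uniformizer_gap[OF w this]
  have "inverse (absF w ^ l * absF y) \<le> absF w" by (simp add: absF_inverse absF_mult absF_power)
  then have "1 \<le> absF w * (absF w ^ l * absF y)"
    using pos y0 by (simp add: inverse_eq_divide pos_divide_le_eq)
  then have "1 \<le> absF y * absF w ^ Suc l" by (simp add: mult_ac)
  moreover have "0 < absF w ^ Suc l" using wp by simp
  ultimately have "1 / absF w ^ Suc l \<le> absF y" by (simp only: pos_divide_le_eq)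
  then show ?thesis by (simp only: power_inverse flip: inverse_eq_divide)
qed

lemma absF_small:
  assumes "uniformizer (w::'F::nonarch_local_field)" and "(0::real) < e"
  shows "\<exists>l\<ge>L. absF w ^ l < e"
proof -
  have "(\<lambda>l. absF w ^ l) \<longlonglongrightarrow> 0" using uniformizer_absF[OF assms(1)] by (intro LIMSEQ_realpow_zero) auto
  then have "eventually (\<lambda>l. absF w ^ l < e) sequentially"
    using assms(2) by (rule order_tendstoD)
  then show ?thesis
    unfolding eventually_sequentially by (meson nle_le)
qed

lemma ideal_pow_eq:
  assumes "uniformizer (w::'F::nonarch_local_field)"
  shows "ideal_pow w l = {y. absF y \<le> absF w ^ l}"
proof -
  note wp = uniformizer_absF[OF assms]
  have "y \<in> ideal_pow w l" if "absF y \<le> absF w ^ l" for y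
    unfolding ideal_pow_def
  proof (rule image_eqI)
    show "y = w ^ l * (y / w ^ l)" using wp by simp
    show "y / w ^ l \<in> integers" using wp that by (simp add: integers_def absF_divide absF_power)
  qed
  moreover have "absF y \<le> absF w ^ l" if "y \<in> ideal_pow w l" for y
    using that by (auto simp: ideal_pow_def integers_def absF_mult absF_power mult_left_le)
  ultimately show ?thesis by blast
qed


section \<open>Topology of the field and of matrices\<close>

text \<open>
  A bounded set lies in a multiple of the ring of integers, which is compact.
\<close>

lemma nonarch_bounded_subset_compact:
  fixes S :: "'F::nonarch_local_field set"
  assumes "\<And>x. x \<in> S \<Longrightarrow> absF x \<le> r"
  shows "\<exists>K. compact K \<and> S \<subseteq> K"
proof -
  obtain y0 :: 'F where y0: "y0 \<noteq> 0" "absF y0 \<noteq> 1" using absF_nontrivial by blast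
  obtain y :: 'F where y: "absF y > 1"
  proof (cases "absF y0 > 1")
    case False
    then have "absF (inverse y0) > 1" using y0 by (simp add: absF_inverse one_less_inverse)
    then show ?thesis using that by blast
  qed (use that in blast)
  obtain k where k: "r \<le> absF y ^ k" using real_arch_pow[OF y] less_imp_le by blast
  have y0: "y \<noteq> 0" using y by auto
  have "continuous_on {x. absF x \<le> 1} (\<lambda>x::'F. y ^ k * x)"
    unfolding continuous_on_iff
  proof safe
    fix x :: 'F and e :: real assume "0 < e"
    have "dist (y ^ k * x') (y ^ k * x) = absF y ^ k * dist x' x" for x'
      by (simp add: dist_absF absF_mult absF_power flip: right_diff_distrib)
    then show "\<exists>d>0. \<forall>x'\<in>{x. absF x \<le> 1}. dist x' x < d \<longrightarrow> dist (y ^ k * x') (y ^ k * x) < e"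
      using y0 \<open>0 < e\<close> by (intro exI[of _ "e / absF y ^ k"]) (simp add: pos_less_divide_eq mult.commute)
  qed
  then have "compact ((\<lambda>x::'F. y ^ k * x) ` {x. absF x \<le> 1})"
    using compact_integers by (rule compact_continuous_image)
  moreover have "S \<subseteq> (\<lambda>x::'F. y ^ k * x) ` {x. absF x \<le> 1}"
  proof
    fix x assume "x \<in> S"
    then have "absF x \<le> absF y ^ k" using assms[of x] k by linarith
    then show "x \<in> (\<lambda>x::'F. y ^ k * x) ` {x. absF x \<le> 1}"
      using y0 by (intro image_eqI[of _ _ "x / y ^ k"]) (simp_all add: absF_divide absF_power pos_divide_le_eq)
  qed
  ultimately show ?thesis by blast
qed

instance nonarch_local_field \<subseteq> heine_borel
proof
  fix f :: "nat \<Rightarrow> 'a"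
  assume "bounded (range f)"
  then obtain r where r: "\<forall>x\<in>range f. dist 0 x \<le> r"
    unfolding bounded_any_center[where a = 0] by blast
  then have "absF x \<le> r" if "x \<in> range f" for x
    using that r by (auto simp: absF_eq_dist dist_commute)
  then obtain K where K: "compact K" "range f \<subseteq> K" using nonarch_bounded_subset_compact by metis
  then have "seq_compact K" by (simp add: compact_imp_seq_compact)
  then show "\<exists>l r. strict_mono (r::nat\<Rightarrow>nat) \<and> ((f \<circ> r) \<longlongrightarrow> l) sequentially"
    using K(2) unfolding seq_compact_def by blast
qed

instance nonarch_local_field \<subseteq> topological_comm_monoid_add
proof
  fix a b :: 'a
  show "((\<lambda>x. fst x + snd x) \<longlongrightarrow> a + b) (nhds a \<times>\<^sub>F nhds b)"
    unfolding nhds_prod[symmetric] tendsto_iff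
  proof safe
    fix e :: real assume e: "0 < e"
    have "dist (fst x + snd x) (a + b) < e" if "dist x (a, b) < e" for x :: "'a \<times> 'a"
    proof -
      have "absF (fst x - a) < e" "absF (snd x - b) < e"
        using that dist_fst_le[of x "(a,b)"] dist_snd_le[of x "(a,b)"]
        by (auto simp flip: dist_absF)
      then show ?thesis
        using absF_ultrametric[of "fst x - a" "snd x - b"] by (simp add: dist_absF algebra_simps)
    qed
    then show "\<forall>\<^sub>F x in nhds (a, b). dist (fst x + snd x) (a + b) < e"
      using e unfolding eventually_nhds_metric by blast
  qed
qed

instance nonarch_local_field \<subseteq> topological_comm_monoid_mult
proof
  fix a b :: 'a
  show "((\<lambda>x. fst x * snd x) \<longlongrightarrow> a * b) (nhds a \<times>\<^sub>F nhds b)"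
    unfolding nhds_prod[symmetric] tendsto_iff
  proof safe
    fix e :: real assume e: "0 < e"
    define B where "B = 1 + absF a + absF b"
    have B: "B \<ge> 1" "absF a \<le> B" "absF b \<le> B" by (simp_all add: B_def)
    define d where "d = min 1 (e / B)"
    have d: "0 < d" "d \<le> 1" "d * B \<le> e" using e B by (auto simp: d_def min_def field_simps)
    have "dist (fst x * snd x) (a * b) < e" if "dist x (a, b) < d" for x :: "'a \<times> 'a"
    proof -
      have x: "absF (fst x - a) < d" "absF (snd x - b) < d"
        using that dist_fst_le[of x "(a,b)"] dist_snd_le[of x "(a,b)"]
        by (auto simp flip: dist_absF)
      have "absF (snd x) \<le> max (absF (snd x - b)) (absF b)"
        using absF_ultrametric[of "snd x - b" b] by simp
      then have sx: "absF (snd x) \<le> B" using x d B by auto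
      have "absF (fst x - a) * absF (snd x) < d * B"
        using x sx B by (meson absF_nonneg le_less_trans mult_left_mono mult_strict_right_mono less_le_trans zero_less_one)
      moreover have "absF a * absF (snd x - b) < d * B"
      proof -
        have "absF a * absF (snd x - b) \<le> B * absF (snd x - b)" using B by (intro mult_right_mono) auto
        also have "\<dots> < B * d" using x B by (intro mult_strict_left_mono) auto
        finally show ?thesis by (simp add: mult.commute)
      qed
      ultimately have lt: "max (absF ((fst x - a) * snd x)) (absF (a * (snd x - b))) < e"
        using d by (simp add: absF_mult)
      have eq: "fst x * snd x - a * b = (fst x - a) * snd x + a * (snd x - b)"
        by (simp add: algebra_simps)
      show ?thesis
        unfolding dist_absF eq by (rule le_less_trans[OF absF_ultrametric lt])
    qed
    then show "\<forall>\<^sub>F x in nhds (a, b). dist (fst x * snd x) (a * b) < e"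
      using d unfolding eventually_nhds_metric by blast
  qed
qed

definition mat_norm :: "'F::nonarch_local_field ^ 'n ^ 'm \<Rightarrow> real" where
  "mat_norm g = Max (range (\<lambda>(i, j). absF (g $ i $ j)))"

lemma mat_norm_le_iff: "mat_norm g \<le> r \<longleftrightarrow> (\<forall>i j. absF (g $ i $ j) \<le> r)"
  unfolding mat_norm_def by (subst Max_le_iff) auto

lemma mat_norm_less_iff: "mat_norm g < r \<longleftrightarrow> (\<forall>i j. absF (g $ i $ j) < r)"
  unfolding mat_norm_def by (subst Max_less_iff) auto

lemma absF_entry_le: "absF (g $ i $ j) \<le> mat_norm g"
  using mat_norm_le_iff by blast

lemma mat_norm_nonneg [simp]: "0 \<le> mat_norm g"
  using order_trans[OF absF_nonneg absF_entry_le] .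

lemma mat_norm_add: "mat_norm (g + h) \<le> max (mat_norm g) (mat_norm h)"
  unfolding mat_norm_le_iff
proof safe
  fix i j
  have "absF ((g + h) $ i $ j) \<le> max (absF (g $ i $ j)) (absF (h $ i $ j))"
    using absF_ultrametric by (simp add: absF_ultrametric)
  then show "absF ((g + h) $ i $ j) \<le> max (mat_norm g) (mat_norm h)"
    using absF_entry_le[of g i j] absF_entry_le[of h i j] by linarith
qed

lemma mat_norm_minus [simp]: "mat_norm (- g) = mat_norm g"
  by (simp add: mat_norm_def)

lemma mat_norm_minus_commute: "mat_norm (g - h) = mat_norm (h - g)"
  using mat_norm_minus[of "g - h"] by simp

lemma mat_norm_diff: "mat_norm (g - h) \<le> max (mat_norm g) (mat_norm h)"
  using mat_norm_add[of g "- h"] by simp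

lemma mat_norm_triangle: "mat_norm (g - k) \<le> max (mat_norm (g - h)) (mat_norm (h - k))"
  using mat_norm_add[of "g - h" "h - k"] by simp

lemma mat_norm_add_eq:
  assumes "mat_norm h < mat_norm g"
  shows "mat_norm (g + h) = mat_norm g"
  using mat_norm_diff[of "g + h" h] mat_norm_add[of g h] assms by auto

lemma mat_norm_0 [simp]: "mat_norm 0 = 0"
  by (simp add: mat_norm_def case_prod_beta)

lemma mat_norm_mult: "mat_norm (g ** h) \<le> mat_norm g * mat_norm h"
  unfolding mat_norm_le_iff matrix_matrix_mult_def
proof (intro allI)
  fix i j
  show "absF ((\<chi> i j. \<Sum>k\<in>UNIV. g $ i $ k * h $ k $ j) $ i $ j) \<le> mat_norm g * mat_norm h"
    by (simp, intro absF_sum_le) (simp_all add: absF_mult mult_mono absF_entry_le)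
qed

lemma absF_trace_le: "absF (trace g) \<le> mat_norm g"
  unfolding trace_def by (intro absF_sum_le) (auto simp: absF_entry_le)

text \<open>
  The two estimates compare the maximum norm with the Euclidean combination of the entrywise
  distances that defines the metric of the matrix space; hence both give the same topology.
\<close>

lemma mat_norm_le_dist: "mat_norm (g - h) \<le> dist g h"
  unfolding mat_norm_le_iff
proof safe
  fix i j
  have "dist (g $ i $ j) (h $ i $ j) \<le> dist (g $ i) (h $ i)" by (rule dist_vec_nth_le)
  also have "\<dots> \<le> dist g h" by (rule dist_vec_nth_le)
  finally show "absF ((g - h) $ i $ j) \<le> dist g h" by (simp add: dist_absF)
qed

lemma dist_le_mat_norm:
  fixes g h :: "'F::nonarch_local_field ^ 'n ^ 'm"
  shows "dist g h \<le> real (CARD('n) * CARD('m)) * mat_norm (g - h)"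
proof -
  have "dist (g $ i) (h $ i) \<le> real CARD('n) * mat_norm (g - h)" for i
  proof -
    have "dist (g $ i) (h $ i) \<le> (\<Sum>j\<in>UNIV. dist (g $ i $ j) (h $ i $ j))"
      unfolding dist_vec_def by (rule L2_set_le_sum) simp
    also have "\<dots> \<le> real CARD('n) * mat_norm (g - h)"
      using absF_entry_le[of "g - h" i] by (intro sum_bounded_above) (simp add: dist_absF)
    finally show ?thesis .
  qed
  then have "(\<Sum>i\<in>UNIV. dist (g $ i) (h $ i)) \<le> real CARD('m) * (real CARD('n) * mat_norm (g - h))"
    by (intro sum_bounded_above)
  moreover have "dist g h \<le> (\<Sum>i\<in>UNIV. dist (g $ i) (h $ i))"
    unfolding dist_vec_def[of g] by (rule L2_set_le_sum) simp
  ultimately show ?thesis by (simp add: algebra_simps)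
qed

lemma open_mat_iff:
  fixes U :: "('F::nonarch_local_field ^ 'n ^ 'm) set"
  shows "open U \<longleftrightarrow> (\<forall>c\<in>U. \<exists>e>0. \<forall>g. mat_norm (g - c) < e \<longrightarrow> g \<in> U)"
proof
  assume U: "open U"
  show "\<forall>c\<in>U. \<exists>e>0. \<forall>g. mat_norm (g - c) < e \<longrightarrow> g \<in> U"
  proof
    fix c assume "c \<in> U"
    then obtain e where e: "e > 0" "\<And>g. dist g c < e \<Longrightarrow> g \<in> U"
      using U unfolding open_dist by blast
    let ?C = "real (CARD('n) * CARD('m))"
    have "g \<in> U" if "mat_norm (g - c) < e / ?C" for g
    proof (rule e(2))
      have "dist g c \<le> ?C * mat_norm (g - c)" by (rule dist_le_mat_norm)
      also have "\<dots> < e" using that by (simp add: field_simps)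
      finally show "dist g c < e" .
    qed
    then show "\<exists>e>0. \<forall>g. mat_norm (g - c) < e \<longrightarrow> g \<in> U"
      using e(1) by (intro exI[of _ "e / ?C"]) simp
  qed
next
  assume "\<forall>c\<in>U. \<exists>e>0. \<forall>g. mat_norm (g - c) < e \<longrightarrow> g \<in> U"
  then show "open U"
    unfolding open_dist by (meson le_less_trans mat_norm_le_dist)
qed

definition mat_cball :: "'F::nonarch_local_field ^ 'n ^ 'n \<Rightarrow> real \<Rightarrow> ('F ^ 'n ^ 'n) set" where
  "mat_cball c r = {h. mat_norm (h - c) \<le> r}"

lemma mem_mat_cball: "h \<in> mat_cball c r \<longleftrightarrow> mat_norm (h - c) \<le> r"
  by (simp add: mat_cball_def)

lemma open_mat_cball:
  assumes "0 < r" shows "open (mat_cball c r)"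
  unfolding open_mat_iff
proof (rule ballI)
  fix h assume "h \<in> mat_cball c r"
  then have "mat_norm (h - c) \<le> r" by (simp add: mem_mat_cball)
  then have "mat_norm (g - c) \<le> r" if "mat_norm (g - h) < r" for g
    using mat_norm_triangle[of g c h] that by auto
  then show "\<exists>e>0. \<forall>g. mat_norm (g - h) < e \<longrightarrow> g \<in> mat_cball c r"
    using assms unfolding mem_mat_cball by blast
qed

lemma closed_mat_cball: "closed (mat_cball c r)"
proof -
  have "mat_cball c r = (\<Inter>i j. {g. dist (g $ i $ j) (c $ i $ j) \<le> r})"
    by (auto simp: mem_mat_cball mat_norm_le_iff dist_absF)
  moreover have "closed {g. dist (g $ i $ j) (c $ i $ j) \<le> r}" for i j
    by (intro closed_Collect_le continuous_intros)
  ultimately show ?thesis by (simp add: closed_INT)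
qed

lemma compact_mat_cball:
  fixes c :: "'F::nonarch_local_field ^ 'n ^ 'n"
  shows "compact (mat_cball c r)"
proof -
  have "bounded (mat_cball c r)"
    unfolding bounded_def
  proof (intro exI ballI)
    fix g assume "g \<in> mat_cball c r"
    then have "real (CARD('n) * CARD('n)) * mat_norm (c - g) \<le> real (CARD('n) * CARD('n)) * r"
      by (intro mult_left_mono) (simp_all add: mem_mat_cball mat_norm_minus_commute)
    then show "dist c g \<le> real (CARD('n) * CARD('n)) * r"
      using dist_le_mat_norm[of c g] by linarith
  qed
  then show ?thesis using closed_mat_cball compact_eq_bounded_closed by blast
qed

lemma continuous_on_trace: "continuous_on S (trace :: 'F::nonarch_local_field ^ 'n ^ 'n \<Rightarrow> 'F)"
  unfolding trace_def by (intro continuous_intros)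

lemma continuous_on_det: "continuous_on S (det :: 'F::nonarch_local_field ^ 'n ^ 'n \<Rightarrow> 'F)"
  unfolding det_def by (intro continuous_intros)

lemma continuous_on_mat_mult [continuous_intros]:
  fixes f g :: "'a::topological_space \<Rightarrow> 'F::nonarch_local_field ^ 'n ^ 'n"
  assumes "continuous_on S f" "continuous_on S g"
  shows "continuous_on S (\<lambda>x. f x ** g x)"
  unfolding matrix_matrix_mult_def
  by (intro continuous_on_vec_lambda continuous_intros assms)

section \<open>Matrices close to the identity\<close>

lemma matrix_add_rdistrib: "(A + B) ** C = A ** C + B ** (C :: 'a::comm_ring_1 ^ 'n ^ 'n)"
  by (simp add: vec_eq_iff matrix_matrix_mult_def sum.distrib distrib_right)

lemma matrix_diff_ldistrib: "A ** (B - C) = A ** B - A ** (C :: 'a::comm_ring_1 ^ 'n ^ 'n)"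
  by (simp add: vec_eq_iff matrix_matrix_mult_def sum_subtractf right_diff_distrib)

lemma matrix_diff_rdistrib: "(A - B) ** C = A ** C - B ** (C :: 'a::comm_ring_1 ^ 'n ^ 'n)"
  by (simp add: vec_eq_iff matrix_matrix_mult_def sum_subtractf left_diff_distrib)

lemma GL_iff: "g \<in> GL \<longleftrightarrow> det g \<noteq> 0"
  by (simp add: GL_def invertible_det_nz)

lemma matrix_inv_right: "g \<in> GL \<Longrightarrow> g ** matrix_inv g = mat 1"
  and matrix_inv_left: "g \<in> GL \<Longrightarrow> matrix_inv g ** g = mat 1"
proof -
  assume "g \<in> GL"
  then have "\<exists>A'. g ** A' = mat 1 \<and> A' ** g = mat 1"
    by (simp add: GL_def invertible_def)
  from someI_ex[OF this] show "g ** matrix_inv g = mat 1" "matrix_inv g ** g = mat 1"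
    by (simp_all add: matrix_inv_def)
qed

lemma matrix_inv_unique:
  assumes "h ** g = mat 1" shows "matrix_inv g = (h :: 'F::nonarch_local_field ^ 'n ^ 'n)"
proof -
  have "g \<in> GL" using assms by (auto simp: GL_def invertible_left_inverse)
  have "matrix_inv g = (h ** g) ** matrix_inv g" using assms by simp
  also have "\<dots> = h" using matrix_inv_right[OF \<open>g \<in> GL\<close>] by (simp flip: matrix_mul_assoc)
  finally show ?thesis .
qed

lemma GL_mult: "g \<in> GL \<Longrightarrow> h \<in> GL \<Longrightarrow> g ** h \<in> GL"
  by (simp add: GL_iff det_mul)

lemma GL_matrix_inv: "g \<in> GL \<Longrightarrow> matrix_inv g \<in> GL"
  using det_mul[of g "matrix_inv g"] by (auto simp: GL_iff matrix_inv_right)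

lemma matrix_inv_inv: "g \<in> GL \<Longrightarrow> matrix_inv (matrix_inv g) = g"
  by (rule matrix_inv_unique) (rule matrix_inv_right)

lemma matrix_inv_mult:
  assumes "g \<in> GL" "h \<in> GL" shows "matrix_inv (g ** h) = matrix_inv h ** matrix_inv g"
proof (rule matrix_inv_unique)
  have "matrix_inv h ** matrix_inv g ** (g ** h) = matrix_inv h ** (matrix_inv g ** g) ** h"
    by (simp add: matrix_mul_assoc)
  then show "matrix_inv h ** matrix_inv g ** (g ** h) = mat 1"
    using assms by (simp add: matrix_inv_left)
qed

lemma absF_sum_less:
  assumes "\<And>i. i \<in> I \<Longrightarrow> absF (f i :: 'F::nonarch_local_field) < r" and "0 < r"
  shows "absF (\<Sum>i\<in>I. f i) < r"
  using assms
proof (induction I rule: infinite_finite_induct)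
  case (insert i I)
  have "absF (f i + (\<Sum>i\<in>I. f i)) \<le> max (absF (f i)) (absF (\<Sum>i\<in>I. f i))"
    by (rule absF_ultrametric)
  also have "\<dots> < r" using insert by simp
  finally show ?case using insert by simp
qed simp_all

text \<open>
  In the Leibniz expansion of the determinant, the identity permutation contributes a product of
  diagonal entries, and each other product contains an off-diagonal entry, hence is strictly smaller.
\<close>

lemma absF_det_dominant_diagonal:
  fixes g :: "'F::nonarch_local_field ^ 'n ^ 'n"
  assumes diag: "\<And>i. absF (g $ i $ i) = R"
    and off: "\<And>i j. i \<noteq> j \<Longrightarrow> absF (g $ i $ j) < R"
    and "0 < R"
  shows "absF (det g) = R ^ CARD('n)"
proof -
  let ?t = "\<lambda>p. of_int (sign p) * (\<Prod>i\<in>UNIV. g $ i $ p i)"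
  let ?P = "{p. p permutes (UNIV :: 'n set)}"
  have absF_t: "absF (?t p) = (\<Prod>i\<in>UNIV. absF (g $ i $ p i))" for p
    by (cases "sign p = 1") (auto simp: absF_mult absF_prod sign_def)
  have le: "absF (g $ i $ j) \<le> R" for i j using diag off by (cases "i = j") (auto intro: less_imp_le)
  have small: "absF (?t p) < R ^ CARD('n)" if "p \<noteq> id" for p
  proof -
    obtain i where i: "p i \<noteq> i" using \<open>p \<noteq> id\<close> by (auto simp: fun_eq_iff)
    have "(\<Prod>i\<in>UNIV. absF (g $ i $ p i)) = absF (g $ i $ p i) * (\<Prod>j\<in>UNIV - {i}. absF (g $ j $ p j))"
      by (rule prod.remove) auto
    also have "\<dots> \<le> absF (g $ i $ p i) * (\<Prod>j\<in>UNIV - {i}. R)"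
      by (intro mult_left_mono prod_mono) (auto simp: le)
    also have "\<dots> < R * (\<Prod>j\<in>UNIV - {i}. R)"
      using i off[of i "p i"] \<open>0 < R\<close> by (intro mult_strict_right_mono) auto
    also have "\<dots> = (\<Prod>j\<in>(UNIV::'n set). R)"
      by (rule prod.remove[symmetric]) auto
    finally show ?thesis by (simp add: absF_t)
  qed
  have "det g = ?t id + (\<Sum>p\<in>?P - {id}. ?t p)"
    unfolding det_def by (rule sum.remove) (auto simp: permutes_id)
  moreover have "absF (?t id) = R ^ CARD('n)" by (subst absF_t) (simp add: diag)
  moreover have "absF (\<Sum>p\<in>?P - {id}. ?t p) < R ^ CARD('n)"
    using small \<open>0 < R\<close> by (intro absF_sum_less) auto
  ultimately show ?thesis by (simp add: absF_add_eq)
qed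

text \<open>
  A matrix at distance less than 1 from the identity acts isometrically, because \<open>(k - 1) g\<close> is
  strictly smaller than \<open>g\<close> and the ultrametric inequality is an equality for summands of different
  size. This also bounds the inverse of \<open>k\<close> without computing it.
\<close>

context
  fixes k :: "'F::nonarch_local_field ^ 'n ^ 'n"
  assumes k: "mat_norm (k - mat 1) < 1"
begin

lemma near_1_absF_det: "absF (det k) = 1"
proof -
  have e: "absF (k $ i $ j - mat 1 $ i $ j) < 1" for i j
    using k by (simp add: mat_norm_less_iff)
  have "absF (k $ i $ i) = 1" for i
    using absF_add_eq[of "k $ i $ i - 1" 1] e[of i i] by (simp add: mat_def)
  moreover have "absF (k $ i $ j) < 1" if "i \<noteq> j" for i j
    using e[of i j] that by (simp add: mat_def)
  ultimately show ?thesis using absF_det_dominant_diagonal[of k 1] by simp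
qed

lemma near_1_in_GL: "k \<in> GL"
  using near_1_absF_det by (auto simp: GL_iff)

lemma near_1_mat_norm_left: "mat_norm (k ** g) = mat_norm (g :: 'F ^ 'n ^ 'n)"
proof -
  have eq: "k ** g = g + (k - mat 1) ** g" by (simp add: matrix_diff_rdistrib)
  have le: "mat_norm ((k - mat 1) ** g) \<le> mat_norm (k - mat 1) * mat_norm g" by (rule mat_norm_mult)
  show ?thesis
  proof (cases "mat_norm g = 0")
    case True
    then have "mat_norm (k ** g) \<le> 0" using mat_norm_mult[of k g] by simp
    then show ?thesis using True mat_norm_nonneg[of "k ** g"] by linarith
  next
    case False
    then have "mat_norm (k - mat 1) * mat_norm g < 1 * mat_norm g"
      using k mat_norm_nonneg[of g] by (intro mult_strict_right_mono) (auto simp: less_le)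
    then show ?thesis unfolding eq using le by (intro mat_norm_add_eq) linarith
  qed
qed

lemma near_1_mat_norm_right: "mat_norm (g ** k) = mat_norm (g :: 'F ^ 'n ^ 'n)"
proof -
  have eq: "g ** k = g + g ** (k - mat 1)" by (simp add: matrix_diff_ldistrib)
  have le: "mat_norm (g ** (k - mat 1)) \<le> mat_norm g * mat_norm (k - mat 1)" by (rule mat_norm_mult)
  show ?thesis
  proof (cases "mat_norm g = 0")
    case True
    then have "mat_norm (g ** k) \<le> 0" using mat_norm_mult[of g k] by simp
    then show ?thesis using True mat_norm_nonneg[of "g ** k"] by linarith
  next
    case False
    then have "mat_norm g * mat_norm (k - mat 1) < mat_norm g * 1"
      using k mat_norm_nonneg[of g] by (intro mult_strict_left_mono) (auto simp: less_le)
    then show ?thesis unfolding eq using le by (intro mat_norm_add_eq) linarith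
  qed
qed

lemma near_1_inverse: "mat_norm (matrix_inv k - mat 1) = mat_norm (k - mat 1)"
proof -
  have "k ** (matrix_inv k - mat 1) = mat 1 - k"
    by (simp add: matrix_diff_ldistrib matrix_inv_right near_1_in_GL)
  then have "mat_norm (matrix_inv k - mat 1) = mat_norm (mat 1 - k)"
    using near_1_mat_norm_left[of "matrix_inv k - mat 1"] by simp
  then show ?thesis by (simp add: mat_norm_minus_commute)
qed

end

lemma open_GL: "open (GL :: ('F::nonarch_local_field ^ 'n ^ 'n) set)"
proof -
  have "GL = det -` (- {0 :: 'F})" by (auto simp: GL_iff)
  then show ?thesis using open_vimage[OF _ continuous_on_det] by (metis open_Compl closed_singleton)
qed

lemma congruence_subgroup_eq:
  assumes "uniformizer w"
  shows "congruence_subgroup w l = {k. mat_norm (k - mat 1) \<le> absF w ^ l}"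
proof -
  have "k \<in> congruence_subgroup w l \<longleftrightarrow> mat_norm (k - mat 1) \<le> absF w ^ l" for k
  proof -
    have "k \<in> congruence_subgroup w l \<longleftrightarrow> (\<forall>i j. (k - mat 1) $ i $ j \<in> ideal_pow w l)"
      unfolding congruence_subgroup_def by (auto intro!: exI[of _ "k - mat 1"])
    then show ?thesis by (simp add: ideal_pow_eq[OF assms] mat_norm_le_iff)
  qed
  then show ?thesis by blast
qed


section \<open>Balls and Haar measure on the matrix space\<close>

lemma borel_mat_cball [measurable]: "mat_cball c r \<in> sets borel"
  by (rule borel_closed[OF closed_mat_cball])

text \<open>Every point of an ultrametric ball is a centre.\<close>

lemma mat_cball_recentre:
  assumes "h \<in> mat_cball c r" shows "mat_cball h r = mat_cball c r"
  unfolding mat_cball_def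
proof (intro Collect_cong iffI)
  have hc: "mat_norm (h - c) \<le> r" "mat_norm (c - h) \<le> r"
    using assms by (simp_all add: mem_mat_cball mat_norm_minus_commute)
  fix g
  show "mat_norm (g - c) \<le> r" if "mat_norm (g - h) \<le> r" using mat_norm_triangle[of g c h] hc that by simp
  show "mat_norm (g - h) \<le> r" if "mat_norm (g - c) \<le> r" using mat_norm_triangle[of g h c] hc that by simp
qed

lemma mat_cball_nested:
  assumes "h \<in> mat_cball c r" "h \<in> mat_cball d s" "r \<le> s"
  shows "mat_cball c r \<subseteq> mat_cball d s"
proof -
  have "mat_cball h r \<subseteq> mat_cball h s" using assms(3) by (auto simp: mem_mat_cball)
  then show ?thesis using assms mat_cball_recentre by metis
qed

text \<open>
  Balls of a fixed radius are pairwise disjoint and open, so a finite subcover of a compact set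
  contains every ball that meets it.
\<close>

lemma finite_mat_cballs:
  fixes S :: "('F::nonarch_local_field ^ 'n ^ 'n) set"
  assumes "0 < r" "S \<subseteq> mat_cball 0 R"
  shows "finite ((\<lambda>c. mat_cball c r) ` S)"
proof -
  have "mat_cball 0 R \<subseteq> (\<Union>c\<in>mat_cball (0 :: 'F ^ 'n ^ 'n) R. mat_cball c r)"
    using assms by (auto simp: mem_mat_cball)
  from compactE_image[OF compact_mat_cball open_mat_cball[OF \<open>0 < r\<close>] this]
  obtain C :: "('F ^ 'n ^ 'n) set" where "C \<subseteq> mat_cball 0 R"
    and C: "finite C" "mat_cball 0 R \<subseteq> (\<Union>c\<in>C. mat_cball c r)" .
  have "(\<lambda>c. mat_cball c r) ` S \<subseteq> (\<lambda>c. mat_cball c r) ` C"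
  proof safe
    fix c assume "c \<in> S"
    from subsetD[OF C(2) subsetD[OF assms(2) this]] have "c \<in> (\<Union>c\<in>C. mat_cball c r)" .
    then obtain c' where c': "c' \<in> C" "c \<in> mat_cball c' r" by (rule UN_E)
    from c'(2) have "mat_cball c r = mat_cball c' r" by (rule mat_cball_recentre)
    with \<open>c' \<in> C\<close> show "mat_cball c r \<in> (\<lambda>c. mat_cball c r) ` C" by (rule rev_image_eqI)
  qed
  then show ?thesis by (rule finite_subset) (rule finite_imageI[OF C(1)])
qed

lemma UN_mat_cball: "(\<Union>N::nat. mat_cball 0 (real N)) = (UNIV :: ('F::nonarch_local_field ^ 'n ^ 'n) set)"
proof (intro equalityI subsetI UNIV_I)
  fix g :: "'F ^ 'n ^ 'n"
  obtain N where "mat_norm g \<le> real N" using real_arch_simple by blast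
  then show "g \<in> (\<Union>N::nat. mat_cball 0 (real N))" by (auto simp: mem_mat_cball)
qed

lemma countable_mat_cballs:
  assumes "0 < r"
  shows "countable (range (\<lambda>c :: 'F::nonarch_local_field ^ 'n ^ 'n. mat_cball c r))"
proof -
  have "range (\<lambda>c :: 'F ^ 'n ^ 'n. mat_cball c r) = (\<Union>N::nat. (\<lambda>c. mat_cball c r) ` mat_cball 0 (real N))"
    unfolding image_UN[symmetric] UN_mat_cball ..
  moreover have "countable ((\<lambda>c :: 'F ^ 'n ^ 'n. mat_cball c r) ` mat_cball 0 (real N))" for N
    by (intro countable_finite finite_mat_cballs[OF assms order_refl])
  ultimately show ?thesis by (simp only: countable_UN[OF countableI_type])
qed

text \<open>
  For each radius \<open>1 / (n + 1)\<close> there are only countably many balls, so an open set is a countable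
  union of balls.
\<close>

lemma sets_borel_mat_cballs:
  "sets (borel :: ('F::nonarch_local_field ^ 'n ^ 'n) measure)
     = sigma_sets UNIV (insert {} {mat_cball c r | c r. 0 < r})" (is "_ = sigma_sets UNIV ?B")
proof
  show "sigma_sets UNIV ?B \<subseteq> sets borel"
    by (rule sets.sigma_sets_subset'[of _ borel, simplified]) (auto intro: borel_mat_cball)
  have "U \<in> sigma_sets UNIV ?B" if U: "open U" for U :: "('F ^ 'n ^ 'n) set"
  proof -
    define \<C> where "\<C> = (\<Union>n::nat. range (\<lambda>c :: 'F ^ 'n ^ 'n. mat_cball c (inverse (real (Suc n)))))"
    have "countable \<C>" unfolding \<C>_def by (intro countable_UN countable_mat_cballs) auto
    then have "countable {C\<in>\<C>. C \<subseteq> U}" by (rule countable_subset[rotated]) auto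
    moreover have "U = \<Union>{C\<in>\<C>. C \<subseteq> U}"
    proof (intro equalityI subsetI)
      fix c assume "c \<in> U"
      then obtain e where e: "0 < e" "\<And>g. mat_norm (g - c) < e \<Longrightarrow> g \<in> U"
        using U unfolding open_mat_iff by blast
      obtain n where "inverse (real (Suc n)) < e" using reals_Archimedean[OF e(1)] by blast
      then have "mat_cball c (inverse (real (Suc n))) \<subseteq> U" "mat_cball c (inverse (real (Suc n))) \<in> \<C>"
        using e(2) by (auto simp: mem_mat_cball \<C>_def)
      moreover have "c \<in> mat_cball c (inverse (real (Suc n)))" by (simp add: mem_mat_cball)
      ultimately show "c \<in> \<Union>{C\<in>\<C>. C \<subseteq> U}" by blast
    qed blast
    moreover have "C \<in> sigma_sets UNIV ?B" if C: "C \<in> \<C>" for C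
    proof -
      obtain c n where "C = mat_cball c (inverse (real (Suc n)))" using C unfolding \<C>_def by blast
      moreover have "0 < inverse (real (Suc n))" by simp
      ultimately show ?thesis by (intro sigma_sets.Basic) blast
    qed
    ultimately show ?thesis
      using sigma_algebra.countable_Union[OF sigma_algebra_sigma_sets[of ?B UNIV], of "{C\<in>\<C>. C \<subseteq> U}"]
      by auto
  qed
  then show "sets borel \<subseteq> sigma_sets UNIV ?B"
    unfolding borel_def by (auto intro!: sigma_sets_mono simp: sets_measure_of)
qed

text \<open>
  Balls form an intersection-stable generator of the Borel sets, because two balls that meet are
  nested.
\<close>

lemma mat_measure_eqI:
  fixes M N :: "('F::nonarch_local_field ^ 'n ^ 'n) measure"
  assumes sets: "sets M = sets borel" "sets N = sets borel"
    and eq: "\<And>c r. 0 < r \<Longrightarrow> emeasure M (mat_cball c r) = emeasure N (mat_cball c r)"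
    and fin: "\<And>r. emeasure M (mat_cball 0 r) \<noteq> \<infinity>"
  shows "M = N"
proof (rule measure_eqI_generator_eq)
  let ?B = "insert {} {mat_cball c r | (c :: 'F ^ 'n ^ 'n) r. 0 < r}"
  show "Int_stable ?B"
  proof (rule Int_stableI)
    fix X Y assume X: "X \<in> ?B" and Y: "Y \<in> ?B"
    show "X \<inter> Y \<in> ?B"
    proof (cases "X \<inter> Y = {}")
      case False
      then obtain h where h: "h \<in> X" "h \<in> Y" by blast
      then obtain c r d s where XY: "X = mat_cball c r" "Y = mat_cball d s" using X Y by auto
      have "X \<subseteq> Y \<or> Y \<subseteq> X"
        using mat_cball_nested[of h c r d s] mat_cball_nested[of h d s c r] h
        unfolding XY by (cases "r \<le> s") auto
      then have "X \<inter> Y = X \<or> X \<inter> Y = Y" by blast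
      then show ?thesis
        by (rule disjE) (simp_all only: X Y)
    qed simp
  qed
  show "emeasure M X = emeasure N X" if "X \<in> ?B" for X
  proof (cases "X = {}")
    case False
    then obtain c r where "X = mat_cball c r" "0 < r" using \<open>X \<in> ?B\<close> by auto
    then show ?thesis by (simp add: eq)
  qed simp
  show "sets M = sigma_sets UNIV ?B"
    by (rule trans[OF sets(1) sets_borel_mat_cballs])
  show "sets N = sigma_sets UNIV ?B" by (rule trans[OF sets(2) sets_borel_mat_cballs])
  show "range (\<lambda>N. mat_cball 0 (real (Suc N))) \<subseteq> ?B"
    by (intro image_subsetI insertI2 CollectI exI conjI, rule refl) simp
  have "mat_cball 0 (real N) \<subseteq> mat_cball (0 :: 'F ^ 'n ^ 'n) (real (Suc N))" for N
    by (simp add: subset_eq mem_mat_cball)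
  then show "(\<Union>N. mat_cball (0 :: 'F ^ 'n ^ 'n) (real (Suc N))) = UNIV"
    using UN_mono[of UNIV UNIV "\<lambda>N. mat_cball 0 (real N)" "\<lambda>N. mat_cball (0 :: 'F ^ 'n ^ 'n) (real (Suc N))"]
    unfolding UN_mat_cball by blast
  show "emeasure M (mat_cball 0 (real (Suc N))) \<noteq> \<infinity>" for N by (rule fin)
qed auto

lemma continuous_on_mat_add:
  "continuous_on S (\<lambda>h. h + v :: 'F::nonarch_local_field ^ 'n ^ 'n)"
proof -
  have "(\<lambda>h. h + v :: 'F ^ 'n ^ 'n) = (\<lambda>h. \<chi> i j. h $ i $ j + v $ i $ j)"
    by (simp add: fun_eq_iff vec_eq_iff)
  then show ?thesis by (simp only:) (intro continuous_on_vec_lambda continuous_intros)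
qed

lemma borel_measurable_mat_add [measurable]:
  "(\<lambda>h. h + v :: 'F::nonarch_local_field ^ 'n ^ 'n) \<in> borel_measurable borel"
  by (rule borel_measurable_continuous_onI) (rule continuous_on_mat_add)

lemma borel_measurable_mat_mult [measurable]:
  fixes a :: "'F::nonarch_local_field ^ 'n ^ 'n"
  shows "(\<lambda>h :: 'F ^ 'n ^ 'n. a ** h) \<in> borel_measurable borel"
    and "(\<lambda>h :: 'F ^ 'n ^ 'n. h ** a) \<in> borel_measurable borel"
  by (auto intro!: borel_measurable_continuous_onI continuous_on_mat_mult continuous_on_const continuous_on_id)

lemma
  fixes \<mu> :: "'F::nonarch_local_field measure"
  assumes "haar_measure_on UNIV (+) \<mu>"
  shows haar_sets: "sets \<mu> = sets borel" and haar_space: "space \<mu> = UNIV"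
    and haar_distr: "distr \<mu> \<mu> ((+) a) = \<mu>"
    and haar_compact: "compact K \<Longrightarrow> emeasure \<mu> K < \<infinity>"
    and haar_open: "open U \<Longrightarrow> U \<noteq> {} \<Longrightarrow> 0 < emeasure \<mu> U"
  using assms unfolding haar_measure_on_def by simp_all

text \<open>
  \<open>lattice_ball g c r\<close> is \<open>c + g B\<close> with \<open>B\<close> the ball of radius \<open>r\<close> around 0. The number
  \<open>lattice_index \<mu> g\<close> is the generalized index of the lattice \<open>g M\<^sub>n(\<oo>)\<close> in \<open>M\<^sub>n(\<oo>)\<close>, the factor by which
  \<open>g\<close> scales the additive Haar measure.
\<close>

definition lattice_ball :: "'F::nonarch_local_field ^ 'n ^ 'n \<Rightarrow> 'F ^ 'n ^ 'n \<Rightarrow> real \<Rightarrow> ('F ^ 'n ^ 'n) set" where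
  "lattice_ball g c r = {h. mat_norm (matrix_inv g ** (h - c)) \<le> r}"

definition lattice_index :: "'F::nonarch_local_field measure \<Rightarrow> 'F ^ 'n ^ 'n \<Rightarrow> real" where
  "lattice_index \<mu> g = measure (mat_measure \<mu>) (lattice_ball g 0 1)
     / measure (mat_measure \<mu>) (mat_cball (0 :: 'F ^ 'n ^ 'n) 1)"

lemma lattice_ball_eq_vimage:
  "lattice_ball (g :: 'F::nonarch_local_field ^ 'n ^ 'n) c r = (\<lambda>h. matrix_inv g ** h) -` mat_cball (matrix_inv g ** c) r"
  by (auto simp: lattice_ball_def mem_mat_cball matrix_diff_ldistrib)

lemma borel_lattice_ball [measurable]: "lattice_ball (g :: 'F::nonarch_local_field ^ 'n ^ 'n) c r \<in> sets borel"
  using measurable_sets[OF borel_measurable_mat_mult(1) borel_mat_cball, of "matrix_inv g" "matrix_inv g ** c" r]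
  by (simp add: lattice_ball_eq_vimage)

context
  fixes \<mu> :: "'F::nonarch_local_field measure"
  assumes haar: "haar_measure_on UNIV (+) \<mu>"
begin

lemma haar_cball: "emeasure \<mu> (cball c r) = emeasure \<mu> (cball 0 r)"
proof -
  have "emeasure \<mu> (cball 0 r) = emeasure (distr \<mu> \<mu> ((+) (- c))) (cball 0 r)"
    by (simp add: haar_distr[OF haar])
  also have "\<dots> = emeasure \<mu> ((+) (- c) -` cball 0 r \<inter> space \<mu>)"
  proof (rule emeasure_distr)
    have "(+) (- c) \<in> borel_measurable borel"
      by (intro borel_measurable_continuous_onI continuous_intros)
    then show "(+) (- c) \<in> measurable \<mu> \<mu>"
      by (simp add: measurable_cong_sets[OF haar_sets[OF haar] haar_sets[OF haar]])
    show "cball 0 r \<in> sets \<mu>" by (simp add: haar_sets[OF haar])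
  qed
  also have "(+) (- c) -` cball 0 r \<inter> space \<mu> = cball c r"
    by (auto simp: haar_space[OF haar] dist_absF algebra_simps)
  finally show ?thesis ..
qed

lemma haar_sigma_finite: "sigma_finite_measure \<mu>"
proof
  show "\<exists>A. countable A \<and> A \<subseteq> sets \<mu> \<and> \<Union>A = space \<mu> \<and> (\<forall>a\<in>A. emeasure \<mu> a \<noteq> \<infinity>)"
  proof (intro exI conjI ballI)
    show "countable (range (\<lambda>n::nat. cball (0::'F) (real n)))" by simp
    show "range (\<lambda>n::nat. cball (0::'F) (real n)) \<subseteq> sets \<mu>" by (auto simp: haar_sets[OF haar])
    show "\<Union>(range (\<lambda>n::nat. cball (0::'F) (real n))) = space \<mu>"
      by (auto simp: haar_space[OF haar] real_arch_simple)
    show "emeasure \<mu> a \<noteq> \<infinity>" if "a \<in> range (\<lambda>n::nat. cball (0::'F) (real n))" for a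
      using that haar_compact[OF haar] by (auto simp: less_top)
  qed
qed

text \<open>
  The Borel structure of the matrix space is that of the product: it is generated by balls, and a
  ball is a product of balls of the field.
\<close>

lemma measurable_mat_of_entries:
  "(\<lambda>f. \<chi> i j. f (i, j)) \<in> measurable (\<Pi>\<^sub>M p\<in>(UNIV :: ('n::finite \<times> 'n) set). \<mu>) (borel :: ('F ^ 'n ^ 'n) measure)"
proof (rule measurable_sigma_sets[OF sets_borel_mat_cballs])
  fix B :: "('F ^ 'n ^ 'n) set" assume "B \<in> insert {} {mat_cball c r | c r. 0 < r}"
  then consider "B = {}" | c r where "B = mat_cball c r" by blast
  then show "(\<lambda>f. \<chi> i j. f (i, j)) -` B \<inter> space (\<Pi>\<^sub>M p\<in>UNIV. \<mu>) \<in> sets (\<Pi>\<^sub>M p\<in>(UNIV :: ('n \<times> 'n) set). \<mu>)"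
  proof cases
    case 2
    have "(\<lambda>f. \<chi> i j. f (i, j)) -` B \<inter> space (\<Pi>\<^sub>M p\<in>UNIV. \<mu>)
        = (\<Pi>\<^sub>E p\<in>UNIV. cball (c $ fst p $ snd p) r)"
      by (auto simp: 2 mem_mat_cball mat_norm_le_iff space_PiM haar_space[OF haar] PiE_iff
          dist_commute[of "c $ _ $ _"] simp flip: dist_absF)
    also have "\<dots> \<in> sets (\<Pi>\<^sub>M p\<in>(UNIV :: ('n \<times> 'n) set). \<mu>)"
      by (intro sets_PiM_I_finite) (auto simp: haar_sets[OF haar])
    finally show ?thesis .
  qed simp
qed auto

lemma sets_mat_measure: "sets (mat_measure \<mu> :: ('F ^ 'n ^ 'n) measure) = sets borel"
  by (simp add: mat_measure_def)

lemma space_mat_measure: "space (mat_measure \<mu> :: ('F ^ 'n ^ 'n) measure) = UNIV"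
  by (simp add: mat_measure_def)

lemma emeasure_mat_cball:
  "emeasure (mat_measure \<mu>) (mat_cball (c :: 'F ^ 'n ^ 'n) r) = emeasure \<mu> (cball 0 r) ^ CARD('n \<times> 'n)"
proof -
  interpret product_sigma_finite "\<lambda>_ :: 'n \<times> 'n. \<mu>"
    by (simp add: product_sigma_finite_def haar_sigma_finite)
  have "emeasure (mat_measure \<mu>) (mat_cball c r) = emeasure (\<Pi>\<^sub>M p\<in>(UNIV :: ('n \<times> 'n) set). \<mu>)
      ((\<lambda>f. \<chi> i j. f (i, j)) -` mat_cball c r \<inter> space (\<Pi>\<^sub>M p\<in>UNIV. \<mu>))"
    unfolding mat_measure_def by (rule emeasure_distr[OF measurable_mat_of_entries]) measurable
  also have "(\<lambda>f. \<chi> i j. f (i, j)) -` mat_cball c r \<inter> space (\<Pi>\<^sub>M p\<in>UNIV. \<mu>)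
      = (\<Pi>\<^sub>E p\<in>UNIV. cball (c $ fst p $ snd p) r)"
    by (auto simp: mem_mat_cball mat_norm_le_iff space_PiM haar_space[OF haar] PiE_iff
        dist_commute[of "c $ _ $ _"] simp flip: dist_absF)
  also have "emeasure (\<Pi>\<^sub>M p\<in>(UNIV :: ('n \<times> 'n) set). \<mu>) \<dots>
      = (\<Prod>p\<in>(UNIV :: ('n \<times> 'n) set). emeasure \<mu> (cball (c $ fst p $ snd p) r))"
    by (intro emeasure_PiM) (auto simp: haar_sets[OF haar])
  also have "\<dots> = (\<Prod>p\<in>(UNIV :: ('n \<times> 'n) set). emeasure \<mu> (cball 0 r))"
    by (rule prod.cong[OF refl haar_cball])
  also have "\<dots> = emeasure \<mu> (cball 0 r) ^ CARD('n \<times> 'n)" by simp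
  finally show ?thesis .
qed

lemma emeasure_mat_cball_finite: "emeasure (mat_measure \<mu>) (mat_cball (c :: 'F ^ 'n ^ 'n) r) < \<infinity>"
  using haar_compact[OF haar, of "cball 0 r"] by (simp add: emeasure_mat_cball power_less_top_ennreal)

lemma measure_mat_cball_pos:
  assumes "0 < r" shows "0 < measure (mat_measure \<mu>) (mat_cball (c :: 'F ^ 'n ^ 'n) r)"
proof -
  have "0 < emeasure \<mu> (ball 0 r)" using assms by (intro haar_open[OF haar]) auto
  also have "\<dots> \<le> emeasure \<mu> (cball 0 r)" by (intro emeasure_mono) (auto simp: haar_sets[OF haar])
  finally have "0 < emeasure (mat_measure \<mu>) (mat_cball c r)"
    by (simp add: emeasure_mat_cball zero_less_iff_neq_zero)
  then show ?thesis
    using emeasure_mat_cball_finite[of c r]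
    by (simp add: measure_def enn2real_positive_iff)
qed

text \<open>
  All balls of one radius have the same volume, so a map under which preimages of balls are balls of
  the same radius preserves the measure.
\<close>

lemma mat_measure_distr_eqI:
  fixes T :: "'F ^ 'n ^ 'n \<Rightarrow> 'F ^ 'n ^ 'n"
  assumes T: "T \<in> borel_measurable borel"
    and ball: "\<And>c r. \<exists>d. T -` mat_cball c r = mat_cball d r"
  shows "distr (mat_measure \<mu>) borel T = mat_measure \<mu>"
proof (rule sym, rule mat_measure_eqI)
  have T': "T \<in> measurable (mat_measure \<mu>) borel"
    using T by (simp add: measurable_cong_sets[OF sets_mat_measure refl])
  fix c r
  obtain d where "T -` mat_cball c r = mat_cball d r" using ball by blast
  then have "emeasure (distr (mat_measure \<mu>) borel T) (mat_cball c r) = emeasure (mat_measure \<mu>) (mat_cball d r)"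
    by (subst emeasure_distr[OF T']) (simp_all add: space_mat_measure)
  then show "emeasure (mat_measure \<mu>) (mat_cball c r) = emeasure (distr (mat_measure \<mu>) borel T) (mat_cball c r)"
    by (simp add: emeasure_mat_cball)
qed (use emeasure_mat_cball_finite in \<open>simp_all add: sets_mat_measure less_top\<close>)

lemma mat_measure_translate: "distr (mat_measure \<mu>) borel (\<lambda>h. h + v) = (mat_measure \<mu> :: ('F ^ 'n ^ 'n) measure)"
proof (rule mat_measure_distr_eqI)
  show "\<exists>d. (\<lambda>h. h + v) -` mat_cball c r = mat_cball d r" for c :: "'F ^ 'n ^ 'n" and r
    by (rule exI[of _ "c - v"]) (auto simp: mem_mat_cball algebra_simps)
qed measurable

lemma mat_measure_near_1:
  assumes "mat_norm (k - mat 1) < 1"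
  shows "distr (mat_measure \<mu>) borel (\<lambda>h. k ** h) = (mat_measure \<mu> :: ('F ^ 'n ^ 'n) measure)"
proof (rule mat_measure_distr_eqI)
  fix c :: "'F ^ 'n ^ 'n" and r
  have "mat_norm (k ** h - c) = mat_norm (h - matrix_inv k ** c)" for h :: "'F ^ 'n ^ 'n"
  proof -
    have "k ** h - c = k ** (h - matrix_inv k ** c)"
      by (simp add: matrix_diff_ldistrib matrix_mul_assoc matrix_inv_right near_1_in_GL[OF assms])
    then show ?thesis by (simp add: near_1_mat_norm_left[OF assms])
  qed
  then show "\<exists>d. (\<lambda>h. k ** h) -` mat_cball c r = mat_cball d r"
    by (intro exI[of _ "matrix_inv k ** c"]) (auto simp: mem_mat_cball)
qed measurable

text \<open>
  How many balls of radius \<open>r\<close> fit in the unit ball is a feature of the metric alone, so the same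
  number serves for every translation-invariant measure.
\<close>

lemma emeasure_unit_ball_count:
  fixes N :: "('F ^ 'n ^ 'n) measure"
  assumes sets: "sets N = sets borel"
    and inv: "\<And>c. emeasure N (mat_cball c r) = emeasure N (mat_cball 0 r)"
    and r: "0 < r" "r \<le> 1"
  shows "emeasure N (mat_cball 0 1) = of_nat (card ((\<lambda>c :: 'F ^ 'n ^ 'n. mat_cball c r) ` mat_cball 0 1)) * emeasure N (mat_cball 0 r)"
proof -
  let ?C = "(\<lambda>c :: 'F ^ 'n ^ 'n. mat_cball c r) ` mat_cball 0 1"
  have "disjoint_family_on (\<lambda>B. B) ?C"
    unfolding disjoint_family_on_def
  proof (intro ballI impI)
    fix A B assume "A \<in> ?C" "B \<in> ?C" "A \<noteq> B"
    then obtain a b where "A = mat_cball a r" "B = mat_cball b r" by auto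
    moreover have "A = B" if "x \<in> A" "x \<in> B" for x
      using calculation mat_cball_recentre[of x a r] mat_cball_recentre[of x b r] that by simp
    ultimately show "A \<inter> B = {}" using \<open>A \<noteq> B\<close> by blast
  qed
  moreover have "(\<Union>B\<in>?C. B) = mat_cball 0 1"
  proof
    show "(\<Union>B\<in>?C. B) \<subseteq> mat_cball 0 1"
    proof (rule UN_least)
      fix B assume "B \<in> ?C"
      then obtain b where b: "B = mat_cball b r" "b \<in> mat_cball 0 1" by auto
      moreover have "b \<in> mat_cball b r" using r by (simp add: mem_mat_cball)
      ultimately show "B \<subseteq> mat_cball 0 1" using mat_cball_nested r by simp
    qed
    show "mat_cball 0 1 \<subseteq> (\<Union>B\<in>?C. B)"
    proof
      fix b :: "'F ^ 'n ^ 'n" assume "b \<in> mat_cball 0 1"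
      moreover have "b \<in> mat_cball b r" using r by (simp add: mem_mat_cball)
      ultimately show "b \<in> (\<Union>B\<in>?C. B)" by auto
    qed
  qed
  moreover have "finite ?C" by (rule finite_mat_cballs[OF r(1) order_refl])
  ultimately have "emeasure N (mat_cball 0 1) = (\<Sum>B\<in>?C. emeasure N B)"
    by (subst sum_emeasure) (auto simp: sets borel_mat_cball)
  also have "\<dots> = (\<Sum>B\<in>?C. emeasure N (mat_cball 0 r))"
    using inv by (intro sum.cong) auto
  finally show ?thesis by simp
qed

lemma emeasure_lattice_ball_centre:
  "emeasure (mat_measure \<mu>) (lattice_ball g c r) = emeasure (mat_measure \<mu>) (lattice_ball (g :: 'F ^ 'n ^ 'n) 0 r)"
proof -
  have "emeasure (mat_measure \<mu>) (lattice_ball g 0 r) = emeasure (distr (mat_measure \<mu>) borel (\<lambda>h. h + (- c))) (lattice_ball g 0 r)"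
    unfolding mat_measure_translate ..
  also have "\<dots> = emeasure (mat_measure \<mu>) ((\<lambda>h. h + (- c)) -` lattice_ball g 0 r \<inter> space (mat_measure \<mu>))"
    by (intro emeasure_distr) (auto simp: measurable_cong_sets[OF sets_mat_measure refl] simp del: add_uminus_conv_diff)
  also have "(\<lambda>h. h + (- c)) -` lattice_ball g 0 r \<inter> space (mat_measure \<mu>) = lattice_ball g c r"
    by (auto simp: lattice_ball_def space_mat_measure)
  finally show ?thesis ..
qed

text \<open>
  Both the Haar measure and its image under \<open>g\<inverse>\<close> are translation invariant, so passing from radius 1
  to radius \<open>r\<close> divides the two volumes by the same number of cosets.
\<close>

lemma measure_lattice_ball:
  assumes "g \<in> GL" "0 < r" "r \<le> 1"
  shows "emeasure (mat_measure \<mu>) (lattice_ball g c r) < \<infinity>"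
    and "measure (mat_measure \<mu>) (lattice_ball (g :: 'F ^ 'n ^ 'n) c r)
      = lattice_index \<mu> g * measure (mat_measure \<mu>) (mat_cball (0 :: 'F ^ 'n ^ 'n) r)"
proof -
  let ?M = "mat_measure \<mu> :: ('F ^ 'n ^ 'n) measure"
  let ?N = "distr ?M borel (\<lambda>h. matrix_inv g ** h)"
  have meas: "(\<lambda>h. matrix_inv g ** h) \<in> measurable ?M borel"
    by (simp add: measurable_cong_sets[OF sets_mat_measure refl])
  have N: "emeasure ?N (mat_cball c r) = emeasure ?M (lattice_ball g 0 r)" for c r
  proof -
    have "emeasure ?N (mat_cball c r) = emeasure ?M ((\<lambda>h. matrix_inv g ** h) -` mat_cball c r)"
      by (subst emeasure_distr[OF meas]) (simp_all add: space_mat_measure)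
    also have "(\<lambda>h. matrix_inv g ** h) -` mat_cball c r = lattice_ball g (g ** c) r"
      using assms(1) by (simp add: lattice_ball_eq_vimage matrix_mul_assoc matrix_inv_left)
    finally show ?thesis using emeasure_lattice_ball_centre by simp
  qed
  let ?n = "card ((\<lambda>c :: 'F ^ 'n ^ 'n. mat_cball c r) ` mat_cball 0 1)"
  have 1: "emeasure ?M (mat_cball 0 1) = of_nat ?n * emeasure ?M (mat_cball 0 r)"
    by (rule emeasure_unit_ball_count) (use assms in \<open>simp_all add: sets_mat_measure emeasure_mat_cball\<close>)
  have N_shift: "emeasure ?N (mat_cball c r) = emeasure ?N (mat_cball 0 r)" for c
    unfolding N ..
  have 2: "emeasure ?M (lattice_ball g 0 1) = of_nat ?n * emeasure ?M (lattice_ball g 0 r)"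
    using emeasure_unit_ball_count[OF _ N_shift assms(2,3)] unfolding N by simp
  have lattice_finite: "emeasure ?M (lattice_ball g 0 s) < \<infinity>" for s
  proof -
    have "lattice_ball g 0 s \<subseteq> mat_cball 0 (mat_norm g * s)"
    proof
      fix h assume "h \<in> lattice_ball g 0 s"
      then have "mat_norm (matrix_inv g ** h) \<le> s" by (simp add: lattice_ball_def)
      then have "mat_norm (g ** (matrix_inv g ** h)) \<le> mat_norm g * s"
        by (intro order_trans[OF mat_norm_mult mult_left_mono]) auto
      then show "h \<in> mat_cball 0 (mat_norm g * s)"
        using assms(1) by (simp add: mem_mat_cball matrix_mul_assoc matrix_inv_right)
    qed
    then have "emeasure ?M (lattice_ball g 0 s) \<le> emeasure ?M (mat_cball 0 (mat_norm g * s))"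
      by (intro emeasure_mono) (auto simp: sets_mat_measure borel_mat_cball)
    then show ?thesis by (rule le_less_trans[OF _ emeasure_mat_cball_finite])
  qed
  then show "emeasure ?M (lattice_ball g c r) < \<infinity>" by (simp add: emeasure_lattice_ball_centre[of g c r])
  have "measure ?M (mat_cball 0 1) = real ?n * measure ?M (mat_cball 0 r)"
    using 1 by (simp add: measure_def enn2real_mult)
  moreover have "measure ?M (lattice_ball g 0 1) = real ?n * measure ?M (lattice_ball g 0 r)"
    using 2 by (simp add: measure_def enn2real_mult)
  moreover have "0 < measure ?M (mat_cball 0 1)" by (rule measure_mat_cball_pos) simp
  moreover have "measure ?M (lattice_ball g c r) = measure ?M (lattice_ball g 0 r)"
    by (simp add: measure_def emeasure_lattice_ball_centre[of g c r])
  ultimately show "measure ?M (lattice_ball g c r) = lattice_index \<mu> g * measure ?M (mat_cball 0 r)"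
    by (auto simp: lattice_index_def)
qed

lemma lattice_index_right:
  assumes "g \<in> GL" "mat_norm (k - mat 1) < 1"
  shows "lattice_index \<mu> (g ** k) = lattice_index \<mu> (g :: 'F ^ 'n ^ 'n)"
proof -
  have "mat_norm (matrix_inv (g ** k) ** h) = mat_norm (matrix_inv g ** h)" for h :: "'F ^ 'n ^ 'n"
  proof -
    have "matrix_inv (g ** k) ** h = matrix_inv k ** (matrix_inv g ** h)"
      using assms by (simp add: matrix_inv_mult near_1_in_GL matrix_mul_assoc)
    then show ?thesis using near_1_mat_norm_left[of "matrix_inv k"] assms(2) by (simp add: near_1_inverse)
  qed
  then have "lattice_ball (g ** k) 0 1 = lattice_ball g 0 1" by (simp add: lattice_ball_def)
  then show ?thesis by (simp add: lattice_index_def)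
qed

text \<open>
  Since \<open>k\<close> permutes balls of each radius, it preserves the Haar measure, in particular the volume of
  the lattice \<open>g M\<^sub>n(\<oo>)\<close>.
\<close>

lemma lattice_index_left:
  assumes "g \<in> GL" "mat_norm (k - mat 1) < 1"
  shows "lattice_index \<mu> (k ** g) = lattice_index \<mu> (g :: 'F ^ 'n ^ 'n)"
proof -
  let ?M = "mat_measure \<mu> :: ('F ^ 'n ^ 'n) measure"
  have k': "mat_norm (matrix_inv k - mat 1) < 1" using assms(2) by (simp add: near_1_inverse)
  have "emeasure ?M (lattice_ball g 0 1) = emeasure (distr ?M borel (\<lambda>h. matrix_inv k ** h)) (lattice_ball g 0 1)"
    by (simp add: mat_measure_near_1[OF k'])
  also have "\<dots> = emeasure ?M ((\<lambda>h. matrix_inv k ** h) -` lattice_ball g 0 1 \<inter> space ?M)"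
    by (intro emeasure_distr) (auto simp: measurable_cong_sets[OF sets_mat_measure refl])
  also have "(\<lambda>h. matrix_inv k ** h) -` lattice_ball g 0 1 \<inter> space ?M = lattice_ball (k ** g) 0 1"
    using assms by (auto simp: lattice_ball_def space_mat_measure matrix_inv_mult near_1_in_GL matrix_mul_assoc)
  finally show ?thesis by (simp add: lattice_index_def measure_def)
qed

end

section \<open>Matrix units and the additive character\<close>

definition matrix_unit :: "'n \<Rightarrow> 'n \<Rightarrow> 'F \<Rightarrow> 'F::nonarch_local_field ^ 'n ^ 'n" where
  "matrix_unit a b t = (\<chi> i j. if i = a \<and> j = b then t else 0)"

lemma mat_norm_matrix_unit: "mat_norm (matrix_unit a b t) \<le> absF t"
  by (simp add: mat_norm_le_iff matrix_unit_def)

lemma trace_mult_matrix_unit: "trace (g ** matrix_unit a b t) = t * g $ b $ a"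
  and trace_matrix_unit_mult: "trace (matrix_unit a b t ** g) = t * g $ b $ a"
proof -
  have "(\<Sum>k\<in>UNIV. g $ i $ k * (if k = a \<and> i = b then t else 0)) = (if i = b then g $ b $ a * t else 0)" for i
    by (cases "i = b") (simp_all add: if_distrib cong: if_cong)
  then show "trace (g ** matrix_unit a b t) = t * g $ b $ a"
    by (simp add: trace_def matrix_matrix_mult_def matrix_unit_def mult.commute)
  then show "trace (matrix_unit a b t ** g) = t * g $ b $ a"
    by (simp only: trace_mul_sym[of "matrix_unit a b t"])
qed

locale unramified_character =
  fixes \<psi> :: "'F::nonarch_local_field \<Rightarrow> complex" and w :: 'F
  assumes uniformizer: "uniformizer w"
    and character: "additive_character \<psi>"
    and trivial_integers: "\<forall>x\<in>integers. \<psi> x = 1"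
    and nontrivial: "\<exists>x\<in>integers. \<psi> (inverse w * x) \<noteq> 1"
begin

abbreviation q :: real where "q \<equiv> inverse (absF w)"

lemma absF_w: "0 < absF w" "absF w < 1" "w \<noteq> 0"
  using uniformizer_absF[OF uniformizer] .

lemma q_gt_1: "1 < q"
  using absF_w by (simp add: one_less_inverse)

lemma q_power_mult: "q ^ l * absF w ^ l = 1"
  using absF_w by (simp flip: power_mult_distrib)

lemma character_add: "\<psi> (x + y) = \<psi> x * \<psi> y"
  using character by (simp add: additive_character_def)

lemma character_integer: "absF x \<le> 1 \<Longrightarrow> \<psi> x = 1"
  using trivial_integers by (simp add: integers_def)

lemma norm_character: "norm (\<psi> x) = 1"
  using character by (simp add: additive_character_def)

lemma character_cong: "absF (x - y) \<le> 1 \<Longrightarrow> \<psi> x = \<psi> y"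
  using character_add[of "x - y" y] by (simp add: character_integer)

lemma character_trace_cong: "mat_norm (g - h) \<le> 1 \<Longrightarrow> \<psi> (trace g) = \<psi> (trace h)"
  using absF_trace_le[of "g - h"] by (intro character_cong) (simp add: trace_def sum_subtractf)

text \<open>
  Under the pairing \<open>\<psi>(t y)\<close> the annihilator of the ideal \<open>\<bar>t\<bar> \<le> q\<^sup>-\<^sup>l\<close> is the ball \<open>\<bar>y\<bar> \<le> q\<^sup>l\<close>. This is the
  orthogonality on which every cancellation below rests.
\<close>

lemma character_detects:
  assumes "q ^ l < absF y"
  shows "\<exists>t. absF t \<le> absF w ^ l \<and> \<psi> (t * y) \<noteq> 1"
proof -
  obtain x where x: "absF x \<le> 1" "\<psi> (inverse w * x) \<noteq> 1"
    using nontrivial by (auto simp: integers_def)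
  have le: "q ^ Suc l \<le> absF y" by (rule absF_gap[OF uniformizer assms])
  have pos: "0 < q ^ Suc l" using absF_w by simp
  then have y: "0 < absF y" using le by linarith
  \<comment> \<open>The choice \<open>t y = w\<inverse> x\<close> is small enough because \<open>\<bar>y\<bar>\<close> exceeds \<open>q\<^sup>l\<close> by a full factor \<open>q\<close>.\<close>
  let ?t = "inverse w * x / y"
  have "absF ?t \<le> q / absF y"
    using x absF_w y by (simp add: absF_divide absF_mult absF_inverse divide_right_mono mult_left_le)
  also have "\<dots> \<le> q / q ^ Suc l" using absF_w le pos by (intro divide_left_mono mult_pos_pos y) auto
  also have "\<dots> = absF w ^ l"
    using absF_w by (simp add: power_inverse divide_inverse)
  finally have "absF ?t \<le> absF w ^ l" .
  moreover have "\<psi> (?t * y) \<noteq> 1" using x y by simp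
  ultimately show ?thesis by blast
qed

lemma borel_measurable_character_trace [measurable]:
  "(\<lambda>h :: 'F ^ 'n ^ 'n. \<psi> (trace h)) \<in> borel_measurable borel"
proof (rule borel_measurable_continuous_onI)
  have "continuous_on UNIV \<psi>" using character by (simp add: additive_character_def)
  then show "continuous_on UNIV (\<lambda>h :: 'F ^ 'n ^ 'n. \<psi> (trace h))"
    by (rule continuous_on_compose2) (auto intro: continuous_on_trace)
qed

end

lemma borel_measurable_absF_det [measurable]:
  "(\<lambda>h :: 'F::nonarch_local_field ^ 'n ^ 'n. absF (det h)) \<in> borel_measurable borel"
  unfolding absF_eq_dist
  by (intro borel_measurable_continuous_onI continuous_intros continuous_on_det)

lemma borel_GL [measurable]: "(GL :: ('F::nonarch_local_field ^ 'n ^ 'n) set) \<in> sets borel"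
  by (rule borel_open[OF open_GL])


section \<open>The smoothed Godement--Jacquet function\<close>

context
  fixes \<mu> :: "'F::nonarch_local_field measure"
  assumes haar: "haar_measure_on UNIV (+) \<mu>"
begin

lemma
  fixes F F' :: "'F ^ 'n ^ 'n \<Rightarrow> 'b::{banach, second_countable_topology}"
  assumes F': "F' \<in> borel_measurable borel" and eq: "\<And>h. h \<in> GL \<Longrightarrow> F h = F' h"
  shows integrable_GL_measure_iff: "integrable (GL_measure \<mu>) F \<longleftrightarrow>
      integrable (mat_measure \<mu>) (\<lambda>h. indicator GL h *\<^sub>R (1 / absF (det h) ^ CARD('n)) *\<^sub>R F' h)" (is ?integrable)
    and integral_GL_measure: "integral\<^sup>L (GL_measure \<mu>) F =
      (LINT h|mat_measure \<mu>. indicator GL h *\<^sub>R (1 / absF (det h) ^ CARD('n)) *\<^sub>R F' h)" (is ?integral)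
proof -
  let ?M = "mat_measure \<mu> :: ('F ^ 'n ^ 'n) measure"
  have GL: "GL \<inter> space ?M \<in> sets ?M" by (simp add: sets_mat_measure[OF haar] space_mat_measure[OF haar])
  have F'M: "F' \<in> borel_measurable (restrict_space ?M GL)"
    using F' by (intro measurable_restrict_space1) (simp add: measurable_cong_sets[OF sets_mat_measure[OF haar] refl])
  have FM: "F \<in> borel_measurable (restrict_space ?M GL)"
    using F'M by (subst measurable_cong[of _ _ F']) (simp_all add: space_restrict_space eq)
  have d: "(\<lambda>h :: 'F ^ 'n ^ 'n. 1 / absF (det h) ^ CARD('n)) \<in> borel_measurable (restrict_space ?M GL)"
    by (intro measurable_restrict_space1) (simp add: measurable_cong_sets[OF sets_mat_measure[OF haar] refl])
  have same: "indicator GL h *\<^sub>R (1 / absF (det h) ^ CARD('n)) *\<^sub>R F h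
      = indicator GL h *\<^sub>R (1 / absF (det h) ^ CARD('n)) *\<^sub>R F' h" for h
    by (auto simp: indicator_def eq)
  show ?integrable
    unfolding GL_measure_def
    by (subst integrable_density[OF FM d])
       (simp_all only: integrable_restrict_space[OF GL] same, simp)
  show ?integral
    unfolding GL_measure_def
    by (subst integral_density[OF FM d])
       (simp_all only: integral_restrict_space[OF GL] same, simp)
qed

context
  fixes \<psi> :: "'F \<Rightarrow> complex" and w :: 'F
  assumes psi: "unramified_character \<psi> w"
begin

interpretation unramified_character \<psi> w by (rule psi)

lemma measure_congruence_subgroup:
  assumes "1 \<le> l"
  shows "measure (GL_measure \<mu>) (congruence_subgroup w l :: ('F ^ 'n ^ 'n) set)
    = measure (mat_measure \<mu>) (mat_cball (0 :: 'F ^ 'n ^ 'n) (absF w ^ l))"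
proof -
  let ?K = "congruence_subgroup w l :: ('F ^ 'n ^ 'n) set"
  have K: "?K = mat_cball (mat 1) (absF w ^ l)"
    by (auto simp: congruence_subgroup_eq[OF uniformizer] mem_mat_cball)
  have lt: "absF w ^ l < 1" using absF_w assms by (simp add: power_less_one_iff)
  have near: "h \<in> GL \<and> absF (det h) = 1" if "h \<in> ?K" for h
    using that lt near_1_in_GL[of h] near_1_absF_det[of h] by (auto simp: K mem_mat_cball)
  then have space: "?K \<subseteq> space (GL_measure \<mu>)"
    by (auto simp: GL_measure_def space_restrict_space space_mat_measure[OF haar])
  have "measure (GL_measure \<mu>) ?K = (LINT h|GL_measure \<mu>. indicator ?K h)"
    using space by (simp add: Int_absorb2)
  also have "\<dots> = (LINT h|mat_measure \<mu>. indicator GL h *\<^sub>R (1 / absF (det h) ^ CARD('n)) *\<^sub>R indicator ?K h)"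
    by (rule integral_GL_measure) (simp_all add: K borel_mat_cball)
  also have "\<dots> = (LINT h|mat_measure \<mu>. indicator ?K h)"
    using near by (intro Bochner_Integration.integral_cong) (auto simp: indicator_def)
  also have "\<dots> = measure (mat_measure \<mu>) (mat_cball (mat 1 :: 'F ^ 'n ^ 'n) (absF w ^ l))"
    by (simp add: K space_mat_measure[OF haar])
  also have "\<dots> = measure (mat_measure \<mu>) (mat_cball (0 :: 'F ^ 'n ^ 'n) (absF w ^ l))"
    by (simp add: measure_def emeasure_mat_cball[OF haar])
  finally show ?thesis .
qed

text \<open>
  The coset \<open>g K\<^sub>l\<close>, described additively as \<open>g + g M\<^sub>n(\<pp>\<^sup>l)\<close>.
\<close>

definition coset :: "'F ^ 'n ^ 'n \<Rightarrow> nat \<Rightarrow> ('F ^ 'n ^ 'n) set" where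
  "coset g l = lattice_ball g g (absF w ^ l)"

context
  fixes g :: "'F ^ 'n ^ 'n" and l :: nat
  assumes g: "g \<in> GL" and l: "1 \<le> l"
begin

lemma coset_iff: "h \<in> coset g l \<longleftrightarrow> mat_norm (matrix_inv g ** h - mat 1) \<le> absF w ^ l"
  by (simp add: coset_def lattice_ball_def matrix_diff_ldistrib matrix_inv_left g)

lemma coset_det:
  assumes "h \<in> coset g l" shows "h \<in> GL" "absF (det h) = absF (det g)"
proof -
  let ?k = "matrix_inv g ** h"
  have "absF w ^ l < 1" using absF_w l by (simp add: power_less_one_iff)
  then have k: "mat_norm (?k - mat 1) < 1" using assms by (simp add: coset_iff)
  have h: "h = g ** ?k" by (simp add: matrix_mul_assoc matrix_inv_right g)
  show "h \<in> GL" by (subst h) (intro GL_mult g near_1_in_GL[OF k])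
  have "absF (det h) = absF (det (g ** ?k))" using h by simp
  also have "\<dots> = absF (det g)"
    by (simp only: det_mul[of g] absF_mult near_1_absF_det[OF k] mult_1_right)
  finally show "absF (det h) = absF (det g)" .
qed

lemma convolution_integrand:
  assumes "h \<in> GL"
  shows "Phi_GJ \<psi> h * inv_pullback (c_fun \<mu> w l) (matrix_inv h ** g)
    = indicator (coset g l) h *\<^sub>R (\<psi> (trace h) * of_real (absF (det g) powr (real CARD('n) / 2)
        / measure (mat_measure \<mu>) (mat_cball (0 :: 'F ^ 'n ^ 'n) (absF w ^ l))))"
proof -
  have "matrix_inv (matrix_inv h ** g) = matrix_inv g ** h"
    using assms g by (simp add: matrix_inv_mult GL_matrix_inv matrix_inv_inv)
  then show ?thesis
    using coset_det[of h] unfolding Phi_GJ_def inv_pullback_def c_fun_def measure_congruence_subgroup[OF l]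
    by (auto simp: congruence_subgroup_eq[OF uniformizer] indicator_def coset_iff)
qed

lemma borel_coset [measurable]: "coset g l \<in> sets borel"
  unfolding coset_def by (rule borel_lattice_ball)

lemma coset_finite: "emeasure (mat_measure \<mu>) (coset g l) < \<infinity>"
  and measure_coset: "measure (mat_measure \<mu>) (coset g l)
    = lattice_index \<mu> g * measure (mat_measure \<mu>) (mat_cball (0 :: 'F ^ 'n ^ 'n) (absF w ^ l))"
  unfolding coset_def using absF_w
  by (intro measure_lattice_ball[OF haar g]; simp add: power_le_one)+

lemma integrable_coset: "integrable (mat_measure \<mu>) (\<lambda>h. indicator (coset g l) h *\<^sub>R (\<psi> (trace h) * c))"
proof (rule integrableI_bounded_set_indicator)
  show "coset g l \<in> sets (mat_measure \<mu>)" by (simp add: sets_mat_measure[OF haar] borel_coset)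
  show "(\<lambda>h. \<psi> (trace h) * c) \<in> borel_measurable (mat_measure \<mu>)"
    by (simp add: measurable_cong_sets[OF sets_mat_measure[OF haar] refl])
  show "emeasure (mat_measure \<mu>) (coset g l) < \<infinity>" by (rule coset_finite)
  show "AE h in mat_measure \<mu>. h \<in> coset g l \<longrightarrow> norm (\<psi> (trace h) * c) \<le> norm c"
    by (simp add: norm_mult norm_character)
qed

lemma coset_weight:
  "indicator GL h *\<^sub>R (1 / absF (det h) ^ CARD('n)) *\<^sub>R indicator (coset g l) h *\<^sub>R (z :: complex)
    = indicator (coset g l) h *\<^sub>R (1 / absF (det g) ^ CARD('n)) *\<^sub>R z"
  using coset_det[of h] by (auto simp: indicator_def)

lemma convolution_integrable:
  "integrable (GL_measure \<mu>) (\<lambda>h. Phi_GJ \<psi> h * inv_pullback (c_fun \<mu> w l) (matrix_inv h ** g))"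
proof (subst integrable_GL_measure_iff[OF _ convolution_integrand])
  show "integrable (mat_measure \<mu>) (\<lambda>h. indicator GL h *\<^sub>R (1 / absF (det h) ^ CARD('n)) *\<^sub>R
      indicator (coset g l) h *\<^sub>R (\<psi> (trace h) * of_real (absF (det g) powr (real CARD('n) / 2)
        / measure (mat_measure \<mu>) (mat_cball (0 :: 'F ^ 'n ^ 'n) (absF w ^ l)))))"
    unfolding coset_weight using integrable_coset[of "of_real (1 / absF (det g) ^ CARD('n))
      * of_real (absF (det g) powr (real CARD('n) / 2)
        / measure (mat_measure \<mu>) (mat_cball (0 :: 'F ^ 'n ^ 'n) (absF w ^ l)))"]
    by (simp add: scaleR_conv_of_real mult_ac)
qed measurable

text \<open>
  If \<open>\<bar>g\<bar> \<le> q\<^sup>l\<close> then \<open>h - g\<close> is integral for every \<open>h\<close> in the coset and the integrand is constant.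
  Otherwise an entry of \<open>g\<close> is larger than \<open>q\<^sup>l\<close>, and translation by \<open>g\<close> times a suitable multiple of a
  matrix unit preserves the coset while it multiplies the integrand by a constant different from 1.
\<close>

lemma integral_character_coset:
  "(LINT h|mat_measure \<mu>. indicator (coset g l) h *\<^sub>R \<psi> (trace h))
    = (if mat_norm g \<le> q ^ l then \<psi> (trace g) * measure (mat_measure \<mu>) (coset g l) else 0)"
proof (cases "mat_norm g \<le> q ^ l")
  case True
  have "\<psi> (trace h) = \<psi> (trace g)" if "h \<in> coset g l" for h
  proof (rule character_trace_cong)
    have "h - g = g ** (matrix_inv g ** h - mat 1)"
      by (simp add: matrix_diff_ldistrib matrix_mul_assoc matrix_inv_right g)
    then have "mat_norm (h - g) \<le> mat_norm g * mat_norm (matrix_inv g ** h - mat 1)"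
      using mat_norm_mult by metis
    also have "\<dots> \<le> q ^ l * absF w ^ l"
      using that True absF_w by (intro mult_mono) (auto simp: coset_iff)
    finally show "mat_norm (h - g) \<le> 1" by (simp add: q_power_mult)
  qed
  then have "(LINT h|mat_measure \<mu>. indicator (coset g l) h *\<^sub>R \<psi> (trace h))
      = (LINT h|mat_measure \<mu>. indicator (coset g l) h *\<^sub>R \<psi> (trace g))"
    by (intro Bochner_Integration.integral_cong) (auto simp: indicator_def)
  also have "\<dots> = measure (mat_measure \<mu>) (coset g l) *\<^sub>R \<psi> (trace g)"
    using coset_finite by (simp add: space_mat_measure[OF haar] sets_mat_measure[OF haar])
  finally show ?thesis using True by (simp add: scaleR_conv_of_real)
next
  case False
  then obtain b a where "q ^ l < absF (g $ b $ a)" by (auto simp: mat_norm_le_iff not_le)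
  then obtain t where t: "absF t \<le> absF w ^ l" "\<psi> (t * g $ b $ a) \<noteq> 1" using character_detects by blast
  let ?v = "g ** matrix_unit a b t"
  let ?f = "\<lambda>h. indicator (coset g l) h *\<^sub>R \<psi> (trace h)"
  have mem: "h + ?v \<in> coset g l \<longleftrightarrow> h \<in> coset g l" for h
  proof -
    have e: "matrix_inv g ** (h + ?v) - mat 1 = (matrix_inv g ** h - mat 1) + matrix_unit a b t"
      by (simp add: matrix_add_ldistrib matrix_mul_assoc matrix_inv_left g)
    have u: "mat_norm (matrix_unit a b t) \<le> absF w ^ l" using mat_norm_matrix_unit t(1) order_trans by blast
    show ?thesis unfolding coset_iff e
      using mat_norm_add[of "matrix_inv g ** h - mat 1" "matrix_unit a b t"]
        mat_norm_diff[of "matrix_inv g ** h - mat 1 + matrix_unit a b t" "matrix_unit a b t"] u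
      by (auto simp: max_def split: if_splits)
  qed
  have "integral\<^sup>L (mat_measure \<mu>) ?f = integral\<^sup>L (distr (mat_measure \<mu>) borel (\<lambda>h. h + ?v)) ?f"
    by (simp add: mat_measure_translate[OF haar])
  also have "\<dots> = (LINT h|mat_measure \<mu>. ?f (h + ?v))"
    by (rule integral_distr) (simp_all add: measurable_cong_sets[OF sets_mat_measure[OF haar] refl])
  also have "\<dots> = (LINT h|mat_measure \<mu>. ?f h * \<psi> (t * g $ b $ a))"
    by (intro Bochner_Integration.integral_cong refl)
       (simp add: indicator_def mem trace_add trace_mult_matrix_unit character_add)
  also have "\<dots> = integral\<^sup>L (mat_measure \<mu>) ?f * \<psi> (t * g $ b $ a)" by (rule integral_mult_left_zero)
  finally have "integral\<^sup>L (mat_measure \<mu>) ?f = 0" using t(2) by simp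
  then show ?thesis using False by simp
qed

text \<open>
  The powers of \<open>\<bar>det g\<bar>\<close> come from \<open>\<Phi>\<close> and from the density of \<open>dh\<close>, which are constant on \<open>g K\<^sub>l\<close>; the
  volume of \<open>K\<^sub>l\<close> cancels against the volume of \<open>g K\<^sub>l\<close> up to the factor \<open>lattice_index \<mu> g\<close>.
\<close>

lemma convolution_eq:
  "convolution \<mu> (Phi_GJ \<psi>) (inv_pullback (c_fun \<mu> w l)) g =
    (if mat_norm g \<le> q ^ l then \<psi> (trace g) * of_real (absF (det g) powr (real CARD('n) / 2)
      / absF (det g) ^ CARD('n) * lattice_index \<mu> g) else 0)"
proof -
  let ?v = "measure (mat_measure \<mu>) (mat_cball (0 :: 'F ^ 'n ^ 'n) (absF w ^ l))"
  let ?d = "absF (det g) powr (real CARD('n) / 2)"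
  have v: "0 < ?v" using absF_w by (intro measure_mat_cball_pos[OF haar]) simp
  have "convolution \<mu> (Phi_GJ \<psi>) (inv_pullback (c_fun \<mu> w l)) g
      = (LINT h|mat_measure \<mu>. indicator GL h *\<^sub>R (1 / absF (det h) ^ CARD('n)) *\<^sub>R
          indicator (coset g l) h *\<^sub>R (\<psi> (trace h) * of_real (?d / ?v)))"
    unfolding convolution_def by (rule integral_GL_measure[OF _ convolution_integrand]) measurable
  also have "\<dots> = (LINT h|mat_measure \<mu>. (indicator (coset g l) h *\<^sub>R \<psi> (trace h)) * of_real (?d / ?v / absF (det g) ^ CARD('n)))"
    unfolding coset_weight
    by (intro Bochner_Integration.integral_cong refl) (simp add: scaleR_conv_of_real mult_ac)
  also have "\<dots> = (LINT h|mat_measure \<mu>. indicator (coset g l) h *\<^sub>R \<psi> (trace h)) * of_real (?d / ?v / absF (det g) ^ CARD('n))"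
    by (rule integral_mult_left_zero)
  finally have "convolution \<mu> (Phi_GJ \<psi>) (inv_pullback (c_fun \<mu> w l)) g
      = (if mat_norm g \<le> q ^ l then \<psi> (trace g) * (lattice_index \<mu> g * ?v) else 0) * of_real (?d / ?v / absF (det g) ^ CARD('n))"
    by (simp only: integral_character_coset measure_coset)
  then show ?thesis using v by simp
qed

end

end

end

section \<open>Coefficients of the contragredient\<close>

context smooth_GL_representation
begin

lemma dual_action_mult:
  assumes "g \<in> GL" "h \<in> GL"
  shows "dual_action V \<pi> (g ** h) f = dual_action V \<pi> g (dual_action V \<pi> h f)"
  using assms maps[OF GL_matrix_inv] map_mult[OF GL_matrix_inv GL_matrix_inv]
  by (simp add: dual_action_def fun_eq_iff matrix_inv_mult)

lemma dual_action_one: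
  assumes "f \<in> smooth_dual sc V \<pi>" shows "dual_action V \<pi> (mat 1) f = f"
proof -
  have "matrix_inv (mat 1) = (mat 1 :: 'b ^ 'c ^ 'c)" by (rule matrix_inv_unique) simp
  then show ?thesis using assms by (auto simp: dual_action_def fun_eq_iff smooth_dual_def map_one)
qed

text \<open>The stabilizer of \<open>g f\<close> is the conjugate by \<open>g\<close> of the stabilizer of \<open>f\<close>.\<close>

lemma dual_action_smooth_dual:
  assumes f: "f \<in> smooth_dual sc V \<pi>" and g: "g \<in> GL"
  shows "dual_action V \<pi> g f \<in> smooth_dual sc V \<pi>"
proof -
  let ?S = "{h \<in> GL. dual_action V \<pi> h f = f}"
  have inv: "matrix_inv g \<in> GL" by (rule GL_matrix_inv[OF g])
  have "dual_action V \<pi> h (dual_action V \<pi> g f) = dual_action V \<pi> g f \<longleftrightarrow> matrix_inv g ** h ** g \<in> ?S"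
    if h: "h \<in> GL" for h
  proof
    assume "dual_action V \<pi> h (dual_action V \<pi> g f) = dual_action V \<pi> g f"
    then have "dual_action V \<pi> (matrix_inv g) (dual_action V \<pi> h (dual_action V \<pi> g f))
        = dual_action V \<pi> (matrix_inv g) (dual_action V \<pi> g f)" by simp
    then show "matrix_inv g ** h ** g \<in> ?S"
      using g h inv by (simp add: GL_mult dual_action_one[OF f] matrix_inv_left matrix_mul_assoc flip: dual_action_mult)
  next
    assume "matrix_inv g ** h ** g \<in> ?S"
    then have "dual_action V \<pi> g (dual_action V \<pi> (matrix_inv g ** h ** g) f) = dual_action V \<pi> g f" by simp
    then have "dual_action V \<pi> (g ** (matrix_inv g ** h ** g)) f = dual_action V \<pi> g f"
      using dual_action_mult[OF g GL_mult[OF GL_mult[OF inv h] g]] by simp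
    then have "dual_action V \<pi> (h ** g) f = dual_action V \<pi> g f"
      using g by (simp add: matrix_mul_assoc matrix_inv_right)
    then show "dual_action V \<pi> h (dual_action V \<pi> g f) = dual_action V \<pi> g f"
      using g h by (simp add: dual_action_mult)
  qed
  then have "{h \<in> GL. dual_action V \<pi> h (dual_action V \<pi> g f) = dual_action V \<pi> g f}
      = GL \<inter> (\<lambda>h. matrix_inv g ** h ** g) -` ?S" by blast
  moreover have "open ((\<lambda>h. matrix_inv g ** h ** g) -` ?S)"
    using f by (intro open_vimage continuous_intros) (simp add: smooth_dual_def)
  ultimately have "open {h \<in> GL. dual_action V \<pi> h (dual_action V \<pi> g f) = dual_action V \<pi> g f}"
    by (simp only: open_Int[OF open_GL])
  moreover have "v + u \<in> V" if "v \<in> V" "u \<in> V" for v u using subspace_add[OF subspace_V] that .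
  moreover have "sc c v \<in> V" if "v \<in> V" for c v using subspace_scale[OF subspace_V] that .
  ultimately show ?thesis
    using f inv maps unfolding smooth_dual_def
    by (simp add: dual_action_def[of _ _ g] map_add map_scale)
qed

end

lemma open_contains_congruence_ball:
  fixes S :: "('F::nonarch_local_field ^ 'n ^ 'n) set"
  assumes "uniformizer (w :: 'F)" "open S" "c \<in> S"
  shows "\<exists>m\<ge>1. \<forall>k. mat_norm (k - c) \<le> absF w ^ m \<longrightarrow> k \<in> S"
proof -
  obtain e where e: "0 < e" "\<And>k. mat_norm (k - c) < e \<Longrightarrow> k \<in> S"
    using assms(2,3) unfolding open_mat_iff by blast
  obtain m where "m \<ge> 1" "absF w ^ m < e" using absF_small[OF assms(1) e(1)] by blast
  then show ?thesis using e(2) by (meson le_less_trans)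
qed

text \<open>
  Right invariance of a coefficient comes from the smooth vector, left invariance from the smooth
  functional.
\<close>

lemma contragredient_coefficient_biinvariant:
  fixes \<pi> :: "'F::nonarch_local_field ^ 'n ^ 'n \<Rightarrow> 'v::ab_group_add \<Rightarrow> 'v"
  assumes "smooth_GL_representation sc V \<pi>" and w: "uniformizer (w :: 'F)"
    and coeff: "contragredient_coefficient sc V \<pi> \<phi>"
  shows "\<exists>m\<ge>1. \<forall>g k. g \<in> GL \<longrightarrow> mat_norm (k - mat 1) \<le> absF w ^ m \<longrightarrow> \<phi> (k ** g) = \<phi> g \<and> \<phi> (g ** k) = \<phi> g"
proof -
  interpret smooth_GL_representation sc V \<pi> by fact
  let ?W = "smooth_dual sc V \<pi>" and ?\<rho> = "dual_action V \<pi>"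
  obtain f F where f: "f \<in> ?W" and F: "F \<in> smooth_dual fun_scale ?W ?\<rho>"
    and \<phi>: "\<And>g. g \<in> GL \<Longrightarrow> \<phi> g = F (?\<rho> g f)"
    using coeff unfolding contragredient_coefficient_def matrix_coefficient_def by blast
  have one: "mat 1 \<in> (GL :: ('F ^ 'n ^ 'n) set)" by (simp add: GL_iff)
  have inv1: "matrix_inv (mat 1) = (mat 1 :: 'F ^ 'n ^ 'n)" by (rule matrix_inv_unique) simp
  have "open {g \<in> GL. ?\<rho> g f = f}" using f by (simp add: smooth_dual_def)
  then obtain m1 where m1: "m1 \<ge> 1" "\<And>k. mat_norm (k - mat 1) \<le> absF w ^ m1 \<Longrightarrow> ?\<rho> k f = f"
    using open_contains_congruence_ball[OF w, of "{g \<in> GL. ?\<rho> g f = f}" "mat 1"] one dual_action_one[OF f] by auto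
  have "open {g \<in> GL. dual_action ?W ?\<rho> g F = F}" using F by (simp add: smooth_dual_def[of fun_scale])
  moreover have "dual_action ?W ?\<rho> (mat 1) F = F"
    using F by (auto simp: dual_action_def[of ?W] fun_eq_iff smooth_dual_def[of fun_scale] inv1 dual_action_one)
  ultimately obtain m2 where m2: "m2 \<ge> 1"
    "\<And>k. mat_norm (k - mat 1) \<le> absF w ^ m2 \<Longrightarrow> dual_action ?W ?\<rho> k F = F"
    using open_contains_congruence_ball[OF w, of "{g \<in> GL. dual_action ?W ?\<rho> g F = F}" "mat 1"] one by auto
  define m where "m = max m1 m2"
  have "1 \<le> m" "m1 \<le> m" "m2 \<le> m" using m1(1) by (auto simp: m_def)
  then have m: "absF w ^ m \<le> absF w ^ m1" "absF w ^ m \<le> absF w ^ m2" "absF w ^ m < 1" "1 \<le> m"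
    using uniformizer_absF[OF w] by (simp_all add: power_decreasing power_less_one_iff)
  have "\<phi> (k ** g) = \<phi> g \<and> \<phi> (g ** k) = \<phi> g"
    if g: "g \<in> GL" and k: "mat_norm (k - mat 1) \<le> absF w ^ m" for g k
  proof
    have k1: "mat_norm (k - mat 1) < 1" using k m by linarith
    have kGL: "k \<in> GL" by (rule near_1_in_GL[OF k1])
    have "?\<rho> k f = f" using m1(2)[of k] k m(1) by simp
    then show "\<phi> (g ** k) = \<phi> g" using g kGL by (simp add: \<phi> GL_mult dual_action_mult)
    have "dual_action ?W ?\<rho> (matrix_inv k) F = F"
      using m2(2)[of "matrix_inv k"] k m near_1_inverse[OF k1] by simp
    then have "dual_action ?W ?\<rho> (matrix_inv k) F (?\<rho> g f) = F (?\<rho> g f)" by simp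
    then have "F (?\<rho> k (?\<rho> g f)) = F (?\<rho> g f)"
      using dual_action_smooth_dual[OF f g] by (simp add: dual_action_def[of ?W] matrix_inv_inv[OF kGL])
    then show "\<phi> (k ** g) = \<phi> g" using g kGL by (simp add: \<phi> GL_mult dual_action_mult)
  qed
  then show ?thesis using m(4) by blast
qed

section \<open>Integration over a fibre of the determinant\<close>

abbreviation det_fibre :: "'F::nonarch_local_field \<Rightarrow> ('F ^ 'n ^ 'n) set" where
  "det_fibre x \<equiv> {g. det g = x}"

lemma closed_det_fibre: "closed (det_fibre x :: ('F::nonarch_local_field ^ 'n ^ 'n) set)"
  by (intro closed_Collect_eq continuous_on_det continuous_intros)

lemma det_det_section: "det (det_section x :: 'F::nonarch_local_field ^ 'n ^ 'n) = x"
  by (subst det_diagonal) (auto simp: det_section_def)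

lemma det_section_mult:
  "(det_section (x * u) :: 'F::nonarch_local_field ^ 'n ^ 'n) = det_section x ** det_section u"
proof -
  have sum: "(\<Sum>k\<in>(UNIV :: 'n set). (if i = k then a else 0) * c k) = a * c i" for i and a :: 'F and c
  proof -
    have "(\<Sum>k\<in>(UNIV :: 'n set). (if i = k then a else 0) * c k) = (\<Sum>k\<in>UNIV. if i = k then a * c k else 0)"
      by (intro sum.cong) auto
    then show ?thesis by simp
  qed
  show ?thesis
    by (simp only: vec_eq_iff det_section_def matrix_matrix_mult_def vec_lambda_beta sum) auto
qed

lemma mat_norm_det_section:
  "mat_norm (det_section u - mat 1 :: 'F::nonarch_local_field ^ 'n ^ 'n) \<le> absF (u - 1)"
  by (simp add: mat_norm_le_iff det_section_def mat_def)

lemma mat_mult_measurable_fibre: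
  fixes a :: "'F::nonarch_local_field ^ 'n ^ 'n"
  assumes "det a = y"
  shows "(\<lambda>g. g ** a) \<in> measurable (restrict_space borel (det_fibre x)) (restrict_space borel (det_fibre (x * y)))"
    and "(\<lambda>g. a ** g) \<in> measurable (restrict_space borel (det_fibre x)) (restrict_space borel (det_fibre (y * x)))"
proof -
  show "(\<lambda>g. g ** a) \<in> measurable (restrict_space borel (det_fibre x)) (restrict_space borel (det_fibre (x * y)))"
    by (rule measurable_restrict_space2[OF _ measurable_restrict_space1[OF borel_measurable_mat_mult(2)]])
       (simp add: space_restrict_space det_mul assms)
  show "(\<lambda>g. a ** g) \<in> measurable (restrict_space borel (det_fibre x)) (restrict_space borel (det_fibre (y * x)))"
    by (rule measurable_restrict_space2[OF _ measurable_restrict_space1[OF borel_measurable_mat_mult(1)]])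
       (simp add: space_restrict_space det_mul assms)
qed

lemma sets_fibre_Int:
  fixes A :: "('F::nonarch_local_field ^ 'n ^ 'n) set"
  assumes "A \<in> sets borel"
  shows "A \<inter> det_fibre x \<in> sets (restrict_space borel (det_fibre x))"
  unfolding sets_restrict_space using imageI[OF assms, of "(\<inter>) (det_fibre x)"] by (simp only: Int_commute)

context
  fixes \<nu> :: "('F::nonarch_local_field ^ 'n ^ 'n) measure"
  assumes haar: "haar_measure_on SL (**) \<nu>"
begin

lemma SL_haar:
  shows "sets \<nu> = sets (restrict_space borel (det_fibre 1))" and "space \<nu> = det_fibre 1"
    and "det k = 1 \<Longrightarrow> distr \<nu> \<nu> ((**) k) = \<nu>"
    and "compact K \<Longrightarrow> K \<subseteq> det_fibre 1 \<Longrightarrow> emeasure \<nu> K < \<infinity>"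
  using haar unfolding haar_measure_on_def SL_def by simp_all

lemma fibre_map_measurable:
  "(\<lambda>h. h ** det_section x) \<in> measurable \<nu> (restrict_space borel (det_fibre x))"
  using mat_mult_measurable_fibre(1)[OF det_det_section[of x], of 1]
  by (simp add: measurable_cong_sets[OF SL_haar(1) refl])

lemma fibre_integral:
  fixes f :: "_ \<Rightarrow> 'b::{banach, second_countable_topology}"
  assumes "f \<in> borel_measurable (restrict_space borel (det_fibre x))"
  shows "integral\<^sup>L (fibre_measure \<nu> x) f = (LINT h|\<nu>. f (h ** det_section x))"
  unfolding fibre_measure_def by (rule integral_distr[OF fibre_map_measurable assms])

lemma sets_fibre_measure: "sets (fibre_measure \<nu> x) = sets (restrict_space borel (det_fibre x))"
  and space_fibre_measure: "space (fibre_measure \<nu> x) = det_fibre x"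
  by (simp_all add: fibre_measure_def space_restrict_space)

text \<open>
  The measure of the fibre is transported along a right multiplication, which commutes with left
  multiplication.
\<close>

lemma fibre_integral_left_mult:
  fixes f :: "_ \<Rightarrow> 'b::{banach, second_countable_topology}"
  assumes k: "det k = 1" and f: "f \<in> borel_measurable (restrict_space borel (det_fibre x))"
  shows "(LINT g|fibre_measure \<nu> x. f (k ** g)) = integral\<^sup>L (fibre_measure \<nu> x) f"
proof -
  have kf: "(\<lambda>g. f (k ** g)) \<in> borel_measurable (restrict_space borel (det_fibre x))"
    using measurable_compose[OF mat_mult_measurable_fibre(2)[OF k, of x]] f by simp
  have k\<nu>: "(**) k \<in> measurable \<nu> \<nu>"
    using mat_mult_measurable_fibre(2)[OF k, of 1] by (simp add: measurable_cong_sets[OF SL_haar(1) SL_haar(1)])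
  have "integral\<^sup>L (fibre_measure \<nu> x) f = (LINT h|distr \<nu> \<nu> ((**) k). f (h ** det_section x))"
    unfolding SL_haar(3)[OF k] by (rule fibre_integral[OF f])
  also have "\<dots> = (LINT h|\<nu>. f (k ** h ** det_section x))"
    by (rule integral_distr[OF k\<nu>]) (rule measurable_compose[OF fibre_map_measurable f])
  also have "\<dots> = (LINT g|fibre_measure \<nu> x. f (k ** g))"
    by (simp add: fibre_integral[OF kf] matrix_mul_assoc)
  finally show ?thesis ..
qed

text \<open>
  A ball cuts the fibre over \<open>x\<close> in a set whose translate to the special linear group is bounded, hence
  contained in a compact set.
\<close>

lemma emeasure_fibre_cball:
  assumes "x \<noteq> 0" shows "emeasure (fibre_measure \<nu> x) (mat_cball 0 R \<inter> det_fibre x) < \<infinity>"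
proof -
  let ?d = "det_section x :: 'F ^ 'n ^ 'n"
  let ?R = "R * mat_norm (matrix_inv ?d)"
  have d: "?d \<in> GL" using assms by (simp add: GL_iff det_det_section)
  let ?K = "mat_cball 0 ?R \<inter> det_fibre 1 :: ('F ^ 'n ^ 'n) set"
  have K: "compact ?K" by (intro compact_Int_closed compact_mat_cball closed_det_fibre)
  have "emeasure (fibre_measure \<nu> x) (mat_cball 0 R \<inter> det_fibre x)
      = emeasure \<nu> ((\<lambda>h. h ** ?d) -` (mat_cball 0 R \<inter> det_fibre x) \<inter> space \<nu>)"
    unfolding fibre_measure_def
    by (rule emeasure_distr[OF fibre_map_measurable sets_fibre_Int[OF borel_mat_cball]])
  also have "\<dots> \<le> emeasure \<nu> ?K"
  proof (rule emeasure_mono)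
    show "(\<lambda>h. h ** ?d) -` (mat_cball 0 R \<inter> det_fibre x) \<inter> space \<nu> \<subseteq> ?K"
    proof
      fix h assume h: "h \<in> (\<lambda>h. h ** ?d) -` (mat_cball 0 R \<inter> det_fibre x) \<inter> space \<nu>"
      then have "mat_norm (h ** ?d) \<le> R" by (simp add: mem_mat_cball)
      then have "mat_norm (h ** ?d ** matrix_inv ?d) \<le> ?R"
        by (intro order_trans[OF mat_norm_mult mult_right_mono]) auto
      then show "h \<in> ?K"
        using h by (simp add: mem_mat_cball SL_haar(2) matrix_inv_right[OF d] flip: matrix_mul_assoc)
    qed
    show "?K \<in> sets \<nu>" unfolding SL_haar(1) by (rule sets_fibre_Int[OF borel_mat_cball])
  qed
  also have "\<dots> < \<infinity>" by (rule SL_haar(4)[OF K]) simp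
  finally show ?thesis .
qed

end


section \<open>Truncated fibre integrals\<close>

text \<open>
  The function \<open>H\<close> stands for the matrix coefficient times the weight produced by the convolution.
\<close>

locale biinvariant_function = unramified_character \<psi> w
  for \<psi> :: "'F::nonarch_local_field \<Rightarrow> complex" and w +
  fixes H :: "'F ^ 'n ^ 'n \<Rightarrow> complex" and m :: nat
  assumes m_pos: "1 \<le> m"
    and left_invariant: "g \<in> GL \<Longrightarrow> mat_norm (k - mat 1) \<le> absF w ^ m \<Longrightarrow> H (k ** g) = H g"
    and right_invariant: "g \<in> GL \<Longrightarrow> mat_norm (k - mat 1) \<le> absF w ^ m \<Longrightarrow> H (g ** k) = H g"
begin

definition truncation :: "nat \<Rightarrow> 'F ^ 'n ^ 'n \<Rightarrow> complex" where
  "truncation l g = (if mat_norm g \<le> q ^ l then \<psi> (trace g) * H g else 0)"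

lemma absF_w_power_m: "absF w ^ m < 1"
  using absF_w m_pos by (simp add: power_less_one_iff)

lemma right_near_1:
  assumes "g \<in> GL" "0 < r"
  shows "\<exists>e>0. \<forall>h. mat_norm (h - g) < e \<longrightarrow> mat_norm (matrix_inv g ** h - mat 1) \<le> r \<and> h = g ** (matrix_inv g ** h)"
proof (intro exI conjI allI impI)
  let ?c = "1 + mat_norm (matrix_inv g)"
  have c: "0 < ?c" by (simp add: add_pos_nonneg)
  show "0 < r / ?c" using c assms(2) by simp
  fix h assume h: "mat_norm (h - g) < r / ?c"
  show "h = g ** (matrix_inv g ** h)" by (simp add: matrix_mul_assoc matrix_inv_right assms)
  have "matrix_inv g ** h - mat 1 = matrix_inv g ** (h - g)"
    by (simp add: matrix_diff_ldistrib matrix_inv_left assms)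
  then have "mat_norm (matrix_inv g ** h - mat 1) \<le> mat_norm (matrix_inv g) * mat_norm (h - g)"
    by (simp add: mat_norm_mult)
  also have "\<dots> \<le> ?c * mat_norm (h - g)" by (intro mult_right_mono) auto
  also have "\<dots> \<le> r" using h c by (simp add: pos_less_divide_eq mult.commute)
  finally show "mat_norm (matrix_inv g ** h - mat 1) \<le> r" .
qed

lemma truncation_locally_constant:
  assumes g: "g \<in> GL"
  shows "\<exists>e>0. \<forall>h. mat_norm (h - g) < e \<longrightarrow> truncation l h = truncation l g"
proof -
  have pos: "0 < absF w ^ m" using absF_w by simp
  from right_near_1[OF g pos] obtain e where e: "0 < e"
    "\<And>h. mat_norm (h - g) < e \<Longrightarrow> mat_norm (matrix_inv g ** h - mat 1) \<le> absF w ^ m \<and> h = g ** (matrix_inv g ** h)"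
    by blast
  have "truncation l h = truncation l g" if h: "mat_norm (h - g) < min e 1" for h
  proof -
    let ?k = "matrix_inv g ** h"
    have k: "mat_norm (?k - mat 1) \<le> absF w ^ m" "h = g ** ?k" using e(2)[of h] h by auto
    have "mat_norm (?k - mat 1) < 1" using k(1) absF_w_power_m by linarith
    then have "mat_norm h = mat_norm g" using k(2) near_1_mat_norm_right[of ?k g] by simp
    moreover have "H h = H g" using right_invariant[OF g k(1)] k(2) by simp
    moreover have "\<psi> (trace h) = \<psi> (trace g)" using h by (intro character_trace_cong) simp
    ultimately show ?thesis by (simp add: truncation_def)
  qed
  moreover have "0 < min e 1" using e(1) by simp
  ultimately show ?thesis by blast
qed

lemma continuous_on_truncation:
  assumes "x \<noteq> 0" shows "continuous_on (det_fibre x) (truncation l)"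
proof -
  have "continuous (at g within det_fibre x) (truncation l)" if "g \<in> det_fibre x" for g
  proof -
    have "g \<in> GL" using that assms by (simp add: GL_iff)
    then obtain e where e: "0 < e" "\<And>h. mat_norm (h - g) < e \<Longrightarrow> truncation l h = truncation l g"
      using truncation_locally_constant by blast
    have eq: "truncation l h = truncation l g" if "dist h g < e" for h
      using e(2)[of h] that mat_norm_le_dist[of h g] by linarith
    have "\<forall>r>0. \<exists>e>0. \<forall>h\<in>det_fibre x. dist h g < e \<longrightarrow> dist (truncation l h) (truncation l g) < r"
    proof (intro allI impI exI[of _ e] conjI ballI)
      show "dist (truncation l h) (truncation l g) < r" if "0 < r" "dist h g < e" for r h
        unfolding eq[OF that(2)] using that(1) by simp
    qed (rule e(1))
    then show ?thesis unfolding continuous_within_eps_delta .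
  qed
  then show ?thesis by (simp add: continuous_on_eq_continuous_within)
qed

lemma borel_measurable_truncation:
  assumes "x \<noteq> 0" shows "truncation l \<in> borel_measurable (restrict_space borel (det_fibre x))"
  by (rule borel_measurable_continuous_on_restrict[OF continuous_on_truncation[OF assms]])

context
  fixes \<nu> :: "('F ^ 'n ^ 'n) measure"
  assumes haar: "haar_measure_on SL (**) \<nu>"
begin

lemma truncation_integrable:
  assumes x: "x \<noteq> 0"
  shows "integrable (fibre_measure \<nu> x) (truncation l)"
proof -
  let ?A = "mat_cball 0 (q ^ l) \<inter> det_fibre x"
  have "compact ?A" by (intro compact_Int_closed compact_mat_cball closed_det_fibre)
  moreover have "continuous_on ?A (truncation l)"
    by (rule continuous_on_subset[OF continuous_on_truncation[OF x]]) simp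
  ultimately have "bounded (truncation l ` ?A)"
    by (intro compact_imp_bounded compact_continuous_image)
  then obtain B where B: "\<And>g. g \<in> ?A \<Longrightarrow> norm (truncation l g) \<le> B" by (auto simp: bounded_iff)
  show ?thesis
  proof (rule integrableI_bounded_set[of ?A])
    show "?A \<in> sets (fibre_measure \<nu> x)"
      unfolding sets_fibre_measure[OF haar] by (rule sets_fibre_Int[OF borel_mat_cball])
    show "truncation l \<in> borel_measurable (fibre_measure \<nu> x)"
      using borel_measurable_truncation[OF x] by (simp add: measurable_cong_sets[OF sets_fibre_measure[OF haar] refl])
    show "emeasure (fibre_measure \<nu> x) ?A < \<infinity>" by (rule emeasure_fibre_cball[OF haar x])
    show "AE g in fibre_measure \<nu> x. g \<in> ?A \<longrightarrow> norm (truncation l g) \<le> B" using B by simp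
    show "AE g in fibre_measure \<nu> x. g \<notin> ?A \<longrightarrow> truncation l g = 0"
      by (rule AE_I2) (auto simp: space_fibre_measure[OF haar] truncation_def mem_mat_cball)
  qed
qed

end

end

section \<open>Multipliers of the additive character on small balls\<close>

context unramified_character
begin

text \<open>
  For an elementary matrix \<open>k = 1 + t E\<^sub>a\<^sub>b\<close> the trace of \<open>k g\<close> is exactly \<open>trace g + t g\<^sub>b\<^sub>a\<close>. On a ball of
  radius \<open>q\<^sup>L\<close> the entry \<open>g\<^sub>b\<^sub>a\<close> varies by at most \<open>q\<^sup>L\<close>, so \<open>\<psi>(t g\<^sub>b\<^sub>a)\<close> is constant there.
\<close>

lemma off_diagonal_multiplier:
  fixes c :: "'F ^ 'n ^ 'n"
  assumes ab: "a \<noteq> b" and large: "q ^ L < absF (c $ b $ a)"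
  shows "\<exists>k \<zeta>. det k = 1 \<and> mat_norm (k - mat 1) \<le> absF w ^ L \<and> \<zeta> \<noteq> 1 \<and>
    (\<forall>g\<in>mat_cball c (q ^ L). \<psi> (trace (k ** g)) = \<zeta> * \<psi> (trace g))"
proof -
  obtain t where t: "absF t \<le> absF w ^ L" "\<psi> (t * c $ b $ a) \<noteq> 1" using character_detects[OF large] by blast
  let ?k = "mat 1 + matrix_unit a b t :: 'F ^ 'n ^ 'n"
  have "?k = (\<chi> k. if k = a then row a (mat 1) + t *s row b (mat 1) else row k (mat 1))"
    using ab by (simp add: vec_eq_iff matrix_unit_def row_def mat_def)
  then have "det ?k = 1" using det_row_operation[OF ab, of "mat 1 :: 'F ^ 'n ^ 'n" t] by simp
  moreover have "mat_norm (?k - mat 1) \<le> absF w ^ L" using mat_norm_matrix_unit[of a b t] t(1) by simp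
  moreover have "\<psi> (trace (?k ** g)) = \<psi> (t * c $ b $ a) * \<psi> (trace g)" if "g \<in> mat_cball c (q ^ L)" for g
  proof -
    have "absF (g $ b $ a - c $ b $ a) \<le> q ^ L"
      using that absF_entry_le[of "g - c" b a] by (simp add: mem_mat_cball)
    then have "absF (t * (g $ b $ a - c $ b $ a)) \<le> absF w ^ L * q ^ L"
      using t(1) absF_w by (simp only: absF_mult) (intro mult_mono, auto)
    then have "\<psi> (t * g $ b $ a) = \<psi> (t * c $ b $ a)"
      using q_power_mult[of L] by (intro character_cong) (simp add: algebra_simps)
    then show ?thesis
      by (simp add: matrix_add_rdistrib trace_add trace_matrix_unit_mult character_add)
  qed
  ultimately show ?thesis using t(2) by blast
qed

text \<open>
  Here \<open>k\<close> is diagonal with entries \<open>1 + t\<close> at \<open>a\<close> and \<open>(1 + t)\<inverse>\<close> at \<open>b\<close>. The trace of \<open>k g\<close> is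
  \<open>trace g + t (g\<^sub>a\<^sub>a - g\<^sub>b\<^sub>b) + t\<^sup>2 (1 + t)\<inverse> g\<^sub>b\<^sub>b\<close>, and the quadratic term is at most \<open>q\<^sup>-\<^sup>2\<^sup>L q\<^sup>L\<^sup>+\<^sup>1 \<le> 1\<close> as
  soon as \<open>L \<ge> 1\<close>, hence invisible to \<open>\<psi>\<close>.
\<close>

lemma diagonal_multiplier:
  fixes c :: "'F ^ 'n ^ 'n"
  assumes ab: "a \<noteq> b" and L: "1 \<le> L" and c: "mat_norm c \<le> q ^ Suc L"
    and large: "q ^ L < absF (c $ a $ a - c $ b $ b)"
  shows "\<exists>k \<zeta>. det k = 1 \<and> mat_norm (k - mat 1) \<le> absF w ^ L \<and> \<zeta> \<noteq> 1 \<and>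
    (\<forall>g\<in>mat_cball c (q ^ L). \<psi> (trace (k ** g)) = \<zeta> * \<psi> (trace g))"
proof -
  let ?\<delta> = "c $ a $ a - c $ b $ b"
  obtain t where t: "absF t \<le> absF w ^ L" "\<psi> (t * ?\<delta>) \<noteq> 1" using character_detects[OF large] by blast
  have "absF w ^ L < 1" using absF_w L by (simp add: power_less_one_iff)
  then have t1: "absF (1 + t) = 1" using absF_add_eq[of t 1] t(1) by simp
  then have t0: "1 + t \<noteq> 0" by auto
  define u where "u i = (if i = a then 1 + t else if i = b then inverse (1 + t) else 1)" for i
  let ?k = "(\<chi> i j. if i = j then u i else 0) :: 'F ^ 'n ^ 'n"
  have "det ?k = (\<Prod>i\<in>UNIV. u i)" by (subst det_diagonal) auto
  also have "\<dots> = (\<Prod>i\<in>{a, b}. u i)" by (rule prod.mono_neutral_right) (auto simp: u_def)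
  also have "\<dots> = 1" using ab t0 by (simp add: u_def)
  finally have "det ?k = 1" .
  have inv: "inverse (1 + t) - 1 = - t * inverse (1 + t)" using t0 by (simp add: field_simps)
  have "absF (u i - 1) \<le> absF w ^ L" for i
    using t(1) absF_w by (auto simp: u_def inv absF_mult absF_inverse t1)
  then have "mat_norm (?k - mat 1) \<le> absF w ^ L"
    using absF_w by (simp add: mat_norm_le_iff mat_def)
  have "\<psi> (trace (?k ** g)) = \<psi> (t * ?\<delta>) * \<psi> (trace g)" if g: "g \<in> mat_cball c (q ^ L)" for g
  proof -
    have e: "absF (g $ i $ j - c $ i $ j) \<le> q ^ L" for i j
      using g absF_entry_le[of "g - c" i j] by (simp add: mem_mat_cball)
    have "q ^ L \<le> q ^ Suc L" using q_gt_1 by (intro power_increasing) auto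
    then have gb: "absF (g $ b $ b) \<le> q ^ Suc L"
      using absF_ultrametric[of "g $ b $ b - c $ b $ b" "c $ b $ b"] e[of b b] absF_entry_le[of c b b] c by simp
    have "trace (?k ** g) = (\<Sum>i\<in>UNIV. u i * g $ i $ i)"
    proof -
      have "(\<Sum>j\<in>UNIV. (if i = j then u i else 0) * g $ j $ i) = (\<Sum>j\<in>UNIV. if i = j then u i * g $ j $ i else 0)" for i
        by (intro sum.cong) auto
      then show ?thesis by (simp add: trace_def matrix_matrix_mult_def)
    qed
    also have "\<dots> = trace g + (\<Sum>i\<in>UNIV. (u i - 1) * g $ i $ i)"
      by (simp add: trace_def left_diff_distrib sum_subtractf)
    also have "(\<Sum>i\<in>UNIV. (u i - 1) * g $ i $ i) = (\<Sum>i\<in>{a, b}. (u i - 1) * g $ i $ i)"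
      by (rule sum.mono_neutral_right) (auto simp: u_def)
    also have "\<dots> = t * (g $ a $ a) + (- t * inverse (1 + t)) * g $ b $ b"
      using ab by (simp add: u_def inv)
    also have "\<dots> = t * ?\<delta> + (t * ((g $ a $ a - c $ a $ a) - (g $ b $ b - c $ b $ b)) + t * t * inverse (1 + t) * g $ b $ b)"
      using t0 by (simp add: field_simps)
    finally have tr: "trace (?k ** g) = trace g + (t * ?\<delta> + (t * ((g $ a $ a - c $ a $ a) - (g $ b $ b - c $ b $ b))
        + t * t * inverse (1 + t) * g $ b $ b))" .
    have "absF (t * ((g $ a $ a - c $ a $ a) - (g $ b $ b - c $ b $ b))) \<le> absF w ^ L * q ^ L"
      unfolding absF_mult using t(1) absF_w e[of a a] e[of b b]
        absF_diff[of "g $ a $ a - c $ a $ a" "g $ b $ b - c $ b $ b"] by (intro mult_mono) auto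
    then have r1: "absF (t * ((g $ a $ a - c $ a $ a) - (g $ b $ b - c $ b $ b))) \<le> 1"
      using q_power_mult[of L] by (simp add: mult.commute)
    have "absF (t * t * inverse (1 + t) * g $ b $ b) \<le> (absF w ^ L * absF w ^ L) * q ^ Suc L"
      unfolding absF_mult absF_inverse t1 using t(1) absF_w gb by (simp, intro mult_mono) auto
    also have "\<dots> = absF w ^ L * q * (q ^ L * absF w ^ L)" by simp
    also have "\<dots> = absF w ^ L * q" by (simp only: q_power_mult mult_1_right)
    also have "\<dots> \<le> absF w ^ 1 * q"
      using absF_w power_decreasing[OF L, of "absF w"] by (intro mult_right_mono) auto
    also have "\<dots> = 1" using absF_w by simp
    finally have r2: "absF (t * t * inverse (1 + t) * g $ b $ b) \<le> 1" .
    have r: "absF (t * ((g $ a $ a - c $ a $ a) - (g $ b $ b - c $ b $ b)) + t * t * inverse (1 + t) * g $ b $ b) \<le> 1"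
      using r1 r2 absF_ultrametric[of "t * ((g $ a $ a - c $ a $ a) - (g $ b $ b - c $ b $ b))" "t * t * inverse (1 + t) * g $ b $ b"]
      by linarith
    show ?thesis
      unfolding tr character_add[of "trace g"] character_add[of "t * ?\<delta>"] character_integer[OF r] by simp
  qed
  then show ?thesis using t(2) \<open>det ?k = 1\<close> \<open>mat_norm (?k - mat 1) \<le> absF w ^ L\<close> by blast
qed

text \<open>
  If all off-diagonal entries and all differences of diagonal entries are at most \<open>q\<^sup>L\<close>, then the
  entry of size \<open>q\<^sup>L\<^sup>+\<^sup>1\<close> is diagonal, all diagonal entries have this size, and the diagonal dominates.
\<close>

lemma scalar_leading_term_det:
  fixes c :: "'F ^ 'n ^ 'n"
  assumes c: "q ^ L < mat_norm c" "mat_norm c \<le> q ^ Suc L"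
    and off: "\<And>a b. a \<noteq> b \<Longrightarrow> absF (c $ b $ a) \<le> q ^ L"
    and diag: "\<And>a b. a \<noteq> b \<Longrightarrow> absF (c $ a $ a - c $ b $ b) \<le> q ^ L"
    and g: "g \<in> mat_cball c (q ^ L)"
  shows "absF (det g) = (q ^ Suc L) ^ CARD('n)"
proof (rule absF_det_dominant_diagonal)
  have lt: "q ^ L < q ^ Suc L" using q_gt_1 by (intro power_strict_increasing) auto
  have e: "absF (g $ i $ j - c $ i $ j) \<le> q ^ L" for i j
    using g absF_entry_le[of "g - c" i j] by (simp add: mem_mat_cball)
  obtain a b where ab: "q ^ L < absF (c $ a $ b)" using c(1) by (auto simp: mat_norm_le_iff not_le[symmetric])
  then have "a = b" using off[of b a] by (cases "a = b") auto
  then have "q ^ Suc L \<le> absF (c $ a $ a)" using absF_gap[OF uniformizer ab] by simp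
  then have aa: "absF (c $ a $ a) = q ^ Suc L" using c(2) absF_entry_le[of c a a] by linarith
  have 0: "0 \<le> q ^ L" using absF_w by simp
  show "absF (g $ i $ i) = q ^ Suc L" for i
  proof -
    have "absF (c $ i $ i - c $ a $ a) \<le> q ^ L" using diag[of i a] 0 by (cases "i = a") auto
    then have "absF ((c $ i $ i - c $ a $ a) + (g $ i $ i - c $ i $ i)) < absF (c $ a $ a)"
      using absF_ultrametric[of "c $ i $ i - c $ a $ a" "g $ i $ i - c $ i $ i"] e[of i i] lt aa by linarith
    from absF_add_eq[OF this] show ?thesis using aa by simp
  qed
  show "absF (g $ i $ j) < q ^ Suc L" if "i \<noteq> j" for i j
    using absF_ultrametric[of "c $ i $ j" "g $ i $ j - c $ i $ j"] e[of i j] off[of j i] that lt by simp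
  show "0 < q ^ Suc L" using absF_w by simp
qed

lemma multiplier_or_det:
  fixes c :: "'F ^ 'n ^ 'n"
  assumes "1 \<le> L" "q ^ L < mat_norm c" "mat_norm c \<le> q ^ Suc L"
  shows "(\<exists>k \<zeta>. det k = 1 \<and> mat_norm (k - mat 1) \<le> absF w ^ L \<and> \<zeta> \<noteq> 1 \<and>
      (\<forall>g\<in>mat_cball c (q ^ L). \<psi> (trace (k ** g)) = \<zeta> * \<psi> (trace g)))
    \<or> (\<forall>g\<in>mat_cball c (q ^ L). absF (det g) = (q ^ Suc L) ^ CARD('n))"
proof (cases "(\<exists>a b. a \<noteq> b \<and> q ^ L < absF (c $ b $ a)) \<or> (\<exists>a b. a \<noteq> b \<and> q ^ L < absF (c $ a $ a - c $ b $ b))")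
  case True
  then show ?thesis
  proof (elim disjE exE conjE)
    fix a b assume "a \<noteq> b" "q ^ L < absF (c $ b $ a)"
    then show ?thesis by (intro disjI1 off_diagonal_multiplier)
  next
    fix a b assume "a \<noteq> b" "q ^ L < absF (c $ a $ a - c $ b $ b)"
    then show ?thesis using diagonal_multiplier[OF _ assms(1,3)] by (intro disjI1) simp
  qed
next
  case False
  then have off: "absF (c $ b $ a) \<le> q ^ L" and diag: "absF (c $ a $ a - c $ b $ b) \<le> q ^ L" if "a \<noteq> b" for a b
    using that by (auto simp: not_less)
  show ?thesis
    by (intro disjI2 ballI scalar_leading_term_det[OF assms(2,3) off diag])
qed

text \<open>
  Multiplication by \<open>k \<in> K\<^sub>L\<close> moves a matrix of size \<open>q\<^sup>L\<^sup>+\<^sup>1\<close> by at most \<open>q\<close>, which is at most \<open>q\<^sup>L\<close>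
  because \<open>L \<ge> 1\<close>.
\<close>

lemma mult_mat_cball_iff:
  fixes c :: "'F ^ 'n ^ 'n"
  assumes L: "1 \<le> L" and c: "mat_norm c \<le> q ^ Suc L" and k: "mat_norm (k - mat 1) \<le> absF w ^ L"
  shows "k ** g \<in> mat_cball c (q ^ L) \<longleftrightarrow> g \<in> mat_cball c (q ^ L)"
    and "g \<in> mat_cball c (q ^ L) \<Longrightarrow> mat_norm g \<le> q ^ Suc L"
proof -
  have "absF w ^ L < 1" using absF_w L by (simp add: power_less_one_iff)
  then have k1: "mat_norm (k - mat 1) < 1" using k by linarith
  have le: "q ^ L \<le> q ^ Suc L" using q_gt_1 by (intro power_increasing) auto
  show small: "mat_norm h \<le> q ^ Suc L" if "h \<in> mat_cball c (q ^ L)" for h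
    using mat_norm_add[of "h - c" c] that le c by (simp add: mem_mat_cball)
  have close: "mat_norm (k ** g - g) \<le> q ^ L" if "mat_norm g \<le> q ^ Suc L"
  proof -
    have "k ** g - g = (k - mat 1) ** g" by (simp add: matrix_diff_rdistrib)
    then have "mat_norm (k ** g - g) \<le> absF w ^ L * q ^ Suc L"
      using mat_norm_mult[of "k - mat 1" g] k that absF_w
      by (metis (no_types) mat_norm_nonneg mult_mono order_trans zero_le_power absF_nonneg)
    also have "\<dots> = q * (q ^ L * absF w ^ L)" by simp
    also have "\<dots> \<le> q ^ L" unfolding q_power_mult using q_gt_1 L by (simp add: self_le_power)
    finally show ?thesis .
  qed
  have eq: "mat_norm (k ** g) = mat_norm g" by (rule near_1_mat_norm_left[OF k1])
  show "k ** g \<in> mat_cball c (q ^ L) \<longleftrightarrow> g \<in> mat_cball c (q ^ L)"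
  proof
    assume a: "k ** g \<in> mat_cball c (q ^ L)"
    then have "mat_norm (k ** g - g) \<le> q ^ L" using close small[OF a] eq by simp
    then show "g \<in> mat_cball c (q ^ L)"
      using a mat_norm_triangle[of g c "k ** g"] by (simp add: mem_mat_cball mat_norm_minus_commute[of g "k ** g"])
  next
    assume a: "g \<in> mat_cball c (q ^ L)"
    then have "mat_norm (k ** g - g) \<le> q ^ L" using close small[OF a] by simp
    then show "k ** g \<in> mat_cball c (q ^ L)"
      using a mat_norm_triangle[of "k ** g" c g] by (simp add: mem_mat_cball)
  qed
qed

end

section \<open>Stability and local constancy of the truncated integrals\<close>

context biinvariant_function
begin

context
  fixes \<nu> :: "('F ^ 'n ^ 'n) measure"
  assumes haar: "haar_measure_on SL (**) \<nu>"
begin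

text \<open>
  A multiplier \<open>k\<close> with constant \<open>\<zeta>\<close> shows that the integral equals \<open>\<zeta>\<close> times itself; if there is none,
  the determinant bound makes the ball disjoint from the fibre.
\<close>

lemma annulus_ball_integral_zero:
  assumes x: "x \<noteq> 0" and L: "m \<le> L" and xL: "absF x < (q ^ Suc L) ^ CARD('n)"
    and c: "q ^ L < mat_norm c" "mat_norm c \<le> q ^ Suc L"
  shows "(LINT g|fibre_measure \<nu> x. indicator (mat_cball c (q ^ L)) g *\<^sub>R truncation (Suc L) g) = 0"
proof -
  let ?f = "\<lambda>g. indicator (mat_cball c (q ^ L)) g *\<^sub>R truncation (Suc L) g"
  have L1: "1 \<le> L" using L m_pos by linarith
  consider k \<zeta> where "det k = 1" "mat_norm (k - mat 1) \<le> absF w ^ L" "\<zeta> \<noteq> 1"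
      "\<And>g. g \<in> mat_cball c (q ^ L) \<Longrightarrow> \<psi> (trace (k ** g)) = \<zeta> * \<psi> (trace g)"
    | "\<And>g. g \<in> mat_cball c (q ^ L) \<Longrightarrow> absF (det g) = (q ^ Suc L) ^ CARD('n)"
    using multiplier_or_det[OF L1 c] by blast
  then show ?thesis
  proof cases
    case 1
    have km: "mat_norm (k - mat 1) \<le> absF w ^ m"
      by (rule order_trans[OF 1(2) power_decreasing[OF L]]) (use absF_w in simp_all)
    then have k1: "mat_norm (k - mat 1) < 1" using absF_w_power_m by linarith
    have f: "?f (k ** g) = \<zeta> * ?f g" if "det g = x" for g
    proof (cases "g \<in> mat_cball c (q ^ L)")
      case True
      have "g \<in> GL" using that x by (simp add: GL_iff)
      then have "H (k ** g) = H g" by (rule left_invariant[OF _ km])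
      moreover have "mat_norm g \<le> q ^ Suc L" by (rule mult_mat_cball_iff(2)[OF L1 c(2) 1(2) True])
      ultimately show ?thesis
        using True 1(4)[OF True] mult_mat_cball_iff(1)[OF L1 c(2) 1(2), of g]
        by (simp add: truncation_def near_1_mat_norm_left[OF k1] del: power_Suc)
    next
      case False
      then show ?thesis using mult_mat_cball_iff(1)[OF L1 c(2) 1(2), of g] by simp
    qed
    have "?f \<in> borel_measurable (restrict_space borel (det_fibre x))"
      by (intro borel_measurable_scaleR borel_measurable_truncation[OF x] measurable_restrict_space1
          borel_measurable_indicator borel_mat_cball)
    then have "integral\<^sup>L (fibre_measure \<nu> x) ?f = (LINT g|fibre_measure \<nu> x. ?f (k ** g))"
      by (rule fibre_integral_left_mult[OF haar 1(1), symmetric])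
    also have "\<dots> = (LINT g|fibre_measure \<nu> x. \<zeta> * ?f g)"
      by (intro Bochner_Integration.integral_cong refl f) (simp add: space_fibre_measure[OF haar])
    also have "\<dots> = \<zeta> * integral\<^sup>L (fibre_measure \<nu> x) ?f" by (rule integral_mult_right_zero)
    finally show ?thesis using 1(3) by simp
  next
    case 2
    have "?f g = 0" if "g \<in> space (fibre_measure \<nu> x)" for g
    proof -
      have "det g = x" using that by (simp add: space_fibre_measure[OF haar])
      then have "g \<notin> mat_cball c (q ^ L)" using 2[of g] xL by auto
      then show ?thesis by simp
    qed
    then have "integral\<^sup>L (fibre_measure \<nu> x) ?f = (LINT g|fibre_measure \<nu> x. 0)"
      by (intro Bochner_Integration.integral_cong refl)
    then show ?thesis by simp
  qed
qed

text \<open>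
  The two truncations differ on an annulus, on which the balls of radius \<open>q\<^sup>L\<close> form a finite
  partition.
\<close>

lemma truncated_integral_stable_Suc:
  assumes x: "x \<noteq> 0" and L: "m \<le> L" and xL: "absF x < (q ^ Suc L) ^ CARD('n)"
  shows "integral\<^sup>L (fibre_measure \<nu> x) (truncation (Suc L)) = integral\<^sup>L (fibre_measure \<nu> x) (truncation L)"
proof -
  let ?N = "fibre_measure \<nu> x"
  define A where "A = {c :: 'F ^ 'n ^ 'n. q ^ L < mat_norm c \<and> mat_norm c \<le> q ^ Suc L}"
  define \<C> where "\<C> = (\<lambda>c. mat_cball c (q ^ L)) ` A"
  have pos: "0 < q ^ L" using absF_w by simp
  have fin: "finite \<C>" unfolding \<C>_def
    by (rule finite_mat_cballs[OF pos, of _ "q ^ Suc L"]) (auto simp: A_def mem_mat_cball)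
  have split: "truncation (Suc L) g - truncation L g = (\<Sum>B\<in>\<C>. indicator B g *\<^sub>R truncation (Suc L) g)" for g
  proof -
    have mem: "B = mat_cball g (q ^ L) \<and> g \<in> A" if B: "B \<in> \<C>" "g \<in> B" for B
    proof -
      obtain c where c: "c \<in> A" "B = mat_cball c (q ^ L)" using B(1) unfolding \<C>_def by blast
      have "mat_norm (g - c) < mat_norm c" using B(2) c by (simp add: A_def mem_mat_cball)
      then have "mat_norm g = mat_norm c" using mat_norm_add_eq[of "g - c" c] by simp
      then show ?thesis using c B(2) mat_cball_recentre[of g c] by (simp add: A_def)
    qed
    show ?thesis
    proof (cases "g \<in> A")
      case True
      let ?B = "mat_cball g (q ^ L)"
      have B: "?B \<in> \<C>" "g \<in> ?B" using True pos by (simp_all add: \<C>_def mem_mat_cball)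
      have "(\<Sum>B\<in>\<C>. indicator B g *\<^sub>R truncation (Suc L) g) = (\<Sum>B\<in>{?B}. indicator B g *\<^sub>R truncation (Suc L) g)"
      proof (rule sum.mono_neutral_right[OF fin])
        have "g \<notin> B'" if "B' \<in> \<C>" "B' \<noteq> ?B" for B' using mem[of B'] that by blast
        then show "\<forall>B'\<in>\<C> - {?B}. indicator B' g *\<^sub>R truncation (Suc L) g = 0" by simp
      qed (use B in simp)
      then show ?thesis using B True by (simp add: truncation_def A_def)
    next
      case False
      have "q ^ L \<le> q ^ Suc L" using q_gt_1 by (intro power_increasing) auto
      then have "truncation (Suc L) g = truncation L g"
        using False unfolding truncation_def A_def by auto
      moreover have "(\<Sum>B\<in>\<C>. indicator B g *\<^sub>R truncation (Suc L) g) = 0"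
      proof (rule sum.neutral)
        have "g \<notin> B'" if "B' \<in> \<C>" for B' using mem[of B'] that False by blast
        then show "\<forall>B'\<in>\<C>. indicator B' g *\<^sub>R truncation (Suc L) g = 0" by simp
      qed
      ultimately show ?thesis by simp
    qed
  qed
  have int: "integrable ?N (\<lambda>g. indicator B g *\<^sub>R truncation (Suc L) g)" if B: "B \<in> \<C>" for B
  proof -
    have "B \<in> sets borel" using B by (auto simp: \<C>_def borel_mat_cball)
    then have "B \<inter> det_fibre x \<in> sets ?N" unfolding sets_fibre_measure[OF haar] by (rule sets_fibre_Int)
    then have int': "integrable ?N (\<lambda>g. indicator (B \<inter> det_fibre x) g *\<^sub>R truncation (Suc L) g)"
      by (rule integrable_mult_indicator[OF _ truncation_integrable[OF haar x]])
    have "indicator (B \<inter> det_fibre x) g *\<^sub>R truncation (Suc L) g = indicator B g *\<^sub>R truncation (Suc L) g"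
      if "g \<in> space ?N" for g
      using that by (simp add: space_fibre_measure[OF haar] indicator_def)
    from iffD1[OF Bochner_Integration.integrable_cong[OF refl this] int'] show ?thesis .
  qed
  have "integral\<^sup>L ?N (truncation (Suc L)) - integral\<^sup>L ?N (truncation L)
      = (LINT g|?N. truncation (Suc L) g - truncation L g)"
    by (rule Bochner_Integration.integral_diff[symmetric]) (rule truncation_integrable[OF haar x])+
  also have "\<dots> = (\<Sum>B\<in>\<C>. LINT g|?N. indicator B g *\<^sub>R truncation (Suc L) g)"
    unfolding split by (rule Bochner_Integration.integral_sum) (rule int)
  also have "\<dots> = 0"
  proof (rule sum.neutral, rule ballI)
    fix B assume "B \<in> \<C>"
    then obtain c where "c \<in> A" "B = mat_cball c (q ^ L)" unfolding \<C>_def by blast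
    then show "(LINT g|?N. indicator B g *\<^sub>R truncation (Suc L) g) = 0"
      using annulus_ball_integral_zero[OF x L xL, of c] by (simp add: A_def)
  qed
  finally show ?thesis by simp
qed

lemma truncated_integral_stable:
  assumes x: "x \<noteq> 0" and L: "m \<le> L" and xL: "absF x < q ^ L" and "L \<le> l"
  shows "integral\<^sup>L (fibre_measure \<nu> x) (truncation l) = integral\<^sup>L (fibre_measure \<nu> x) (truncation L)"
  using \<open>L \<le> l\<close>
proof (induction l rule: dec_induct)
  case (step l)
  have "q ^ L \<le> q ^ Suc l" using q_gt_1 step by (intro power_increasing) auto
  also have "\<dots> \<le> (q ^ Suc l) ^ CARD('n)" using q_gt_1 by (intro self_le_power one_le_power) auto
  finally have "absF x < (q ^ Suc l) ^ CARD('n)" using xL by linarith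
  then show ?case using truncated_integral_stable_Suc[OF x, of l] step L by simp
qed simp

text \<open>
  The two fibres have the common parameter space \<open>SL\<^sub>n\<close>, and there the integrands agree: \<open>diag(u,1,\<dots>,1)\<close>
  lies in \<open>K\<^sub>l\<close>, which changes the trace of a matrix of size \<open>q\<^sup>l\<close> by an integer only.
\<close>

lemma truncated_integral_locally_constant:
  assumes x: "x \<noteq> 0" and l: "m \<le> l" and u: "absF (u - 1) \<le> absF w ^ l"
  shows "integral\<^sup>L (fibre_measure \<nu> (x * u)) (truncation l) = integral\<^sup>L (fibre_measure \<nu> x) (truncation l)"
proof -
  let ?d = "det_section u :: 'F ^ 'n ^ 'n"
  have dl: "mat_norm (?d - mat 1) \<le> absF w ^ l" using mat_norm_det_section[of u] u by (rule order_trans)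
  have dm: "mat_norm (?d - mat 1) \<le> absF w ^ m"
    by (rule order_trans[OF dl power_decreasing[OF l]]) (use absF_w in simp_all)
  then have d1: "mat_norm (?d - mat 1) < 1" using absF_w_power_m by linarith
  have "u \<noteq> 0" using near_1_in_GL[OF d1] by (simp add: GL_iff det_det_section)
  then have xu: "x * u \<noteq> 0" using x by simp
  have "truncation l (g ** ?d) = truncation l g" if "g \<in> GL" for g
  proof (cases "mat_norm g \<le> q ^ l")
    case True
    have "g ** ?d - g = g ** (?d - mat 1)" by (simp add: matrix_diff_ldistrib)
    then have "mat_norm (g ** ?d - g) \<le> mat_norm g * mat_norm (?d - mat 1)" by (simp add: mat_norm_mult)
    also have "\<dots> \<le> q ^ l * absF w ^ l" using True dl absF_w by (intro mult_mono) auto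
    finally have "mat_norm (g ** ?d - g) \<le> 1" by (simp only: q_power_mult)
    then have "\<psi> (trace (g ** ?d)) = \<psi> (trace g)" by (rule character_trace_cong)
    then show ?thesis
      by (simp add: truncation_def near_1_mat_norm_right[OF d1] right_invariant[OF that dm])
  next
    case False
    then show ?thesis by (simp add: truncation_def near_1_mat_norm_right[OF d1])
  qed
  then have "(LINT h|\<nu>. truncation l (h ** det_section (x * u))) = (LINT h|\<nu>. truncation l (h ** det_section x))"
    using x by (intro Bochner_Integration.integral_cong refl)
      (simp add: det_section_mult matrix_mul_assoc SL_haar(2)[OF haar] GL_iff det_mul det_det_section)
  then show ?thesis
    unfolding fibre_integral[OF haar borel_measurable_truncation[OF x]]
      fibre_integral[OF haar borel_measurable_truncation[OF xu]] .
qed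

end

end

section \<open>The kernel function\<close>

text \<open>
  The factor between \<open>\<psi>(trace g)\<close> and the convolution in \<open>convolution_eq\<close>.
\<close>

definition kernel_weight :: "'F::nonarch_local_field measure \<Rightarrow> 'F ^ 'n ^ 'n \<Rightarrow> real" where
  "kernel_weight \<mu> g = absF (det g) powr (real CARD('n) / 2) / absF (det g) ^ CARD('n) * lattice_index \<mu> g"

lemma kernel_integrand_eq_truncation:
  fixes g :: "'F::nonarch_local_field ^ 'n ^ 'n"
  assumes "biinvariant_function \<psi> w (\<lambda>g. of_real (kernel_weight \<mu> g) * \<phi> g) m"
    and "haar_measure_on UNIV (+) \<mu>" and "g \<in> GL" and "1 \<le> l"
  shows "kernel_integrand \<psi> \<mu> w \<phi> l g
    = biinvariant_function.truncation \<psi> w (\<lambda>g. of_real (kernel_weight \<mu> g) * \<phi> g) l g"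
proof -
  interpret biinvariant_function \<psi> w "\<lambda>g. of_real (kernel_weight \<mu> g) * \<phi> g" m by fact
  show ?thesis
    unfolding kernel_integrand_def convolution_eq[OF assms(2) unramified_character_axioms assms(3,4)] truncation_def
    by (simp add: kernel_weight_def)
qed

lemma kernel_weight_mult_near_1:
  fixes g :: "'F::nonarch_local_field ^ 'n ^ 'n"
  assumes "haar_measure_on UNIV (+) \<mu>" "g \<in> GL" "mat_norm (k - mat 1) < 1"
  shows "kernel_weight \<mu> (k ** g) = kernel_weight \<mu> g" "kernel_weight \<mu> (g ** k) = kernel_weight \<mu> g"
  using assms
  by (simp_all add: kernel_weight_def det_mul absF_mult near_1_absF_det lattice_index_left lattice_index_right)

theorem proposition3p5:
  fixes \<psi> :: "'F::{nonarch_local_field, field_char_0} \<Rightarrow> complex"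
    and w :: 'F
    and \<mu> :: "'F measure"
    and \<nu> :: "('F ^ 'n ^ 'n) measure"
    and sc :: "complex \<Rightarrow> 'v::ab_group_add \<Rightarrow> 'v"
    and V :: "'v set"
    and \<pi> :: "'F ^ 'n ^ 'n \<Rightarrow> 'v \<Rightarrow> 'v"
    and \<phi> :: "'F ^ 'n ^ 'n \<Rightarrow> complex"
  assumes "uniformizer w"
    and "additive_character \<psi>"
    and "\<forall>x\<in>integers. \<psi> x = 1"
    and "\<exists>x\<in>integers. \<psi> (inverse w * x) \<noteq> 1"
    and "self_dual_haar \<psi> \<mu>"
    and "haar_measure_on SL (**) \<nu>"
    and "irreducible_smooth_GL_representation sc V \<pi>"
    and "contragredient_coefficient sc V \<pi> \<phi>"
    and "\<phi> (mat 1) = 1"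
  shows "(\<forall>l\<ge>1. \<forall>g\<in>(GL :: ('F ^ 'n ^ 'n) set). integrable (GL_measure \<mu>)
             (\<lambda>h. Phi_GJ \<psi> h * inv_pullback (c_fun \<mu> w l) (matrix_inv h ** g)))
       \<and> (\<forall>x. x \<noteq> 0 \<longrightarrow> (\<forall>l\<ge>1. integrable (fibre_measure \<nu> x) (kernel_integrand \<psi> \<mu> w \<phi> l)))
       \<and> (\<forall>x. x \<noteq> 0 \<longrightarrow> convergent (kernel_seq \<psi> \<mu> \<nu> w \<phi> x))
       \<and> smooth_on (- {0}) (pi_kernel \<psi> \<mu> \<nu> w \<phi>)"
proof -
  have haar: "haar_measure_on UNIV (+) \<mu>" using assms(5) by (simp add: self_dual_haar_def)
  interpret unramified_character \<psi> w by unfold_locales (use assms in auto)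
  have "smooth_GL_representation sc V \<pi>"
    using assms(7) by (simp add: irreducible_smooth_GL_representation_def)
  from contragredient_coefficient_biinvariant[OF this assms(1,8)] obtain m where m: "1 \<le> m"
    "\<And>g k. g \<in> GL \<Longrightarrow> mat_norm (k - mat 1) \<le> absF w ^ m \<Longrightarrow> \<phi> (k ** g) = \<phi> g \<and> \<phi> (g ** k) = \<phi> g"
    by blast
  have wm: "absF w ^ m < 1" using absF_w m(1) by (simp add: power_less_one_iff)
  let ?H = "\<lambda>g. of_real (kernel_weight \<mu> g) * \<phi> g"
  interpret biinvariant_function \<psi> w ?H m
  proof
    fix g k :: "'F ^ 'n ^ 'n" assume g: "g \<in> GL" and k: "mat_norm (k - mat 1) \<le> absF w ^ m"
    have "mat_norm (k - mat 1) < 1" using k wm by linarith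
    from kernel_weight_mult_near_1[OF haar g this] m(2)[OF g k]
    show "?H (k ** g) = ?H g" "?H (g ** k) = ?H g" by simp_all
  qed (rule m(1))
  have integrand: "kernel_integrand \<psi> \<mu> w \<phi> l g = truncation l g" if "g \<in> GL" "1 \<le> l" for l g
    by (rule kernel_integrand_eq_truncation[OF biinvariant_function_axioms haar that])
  have on_fibre: "kernel_integrand \<psi> \<mu> w \<phi> l g = truncation l g"
    if "x \<noteq> 0" "1 \<le> l" "g \<in> space (fibre_measure \<nu> x)" for x l g
    using that by (intro integrand) (auto simp: space_fibre_measure[OF assms(6)] GL_iff)
  have kernel: "kernel_seq \<psi> \<mu> \<nu> w \<phi> x l = integral\<^sup>L (fibre_measure \<nu> x) (truncation l)"
    if "x \<noteq> 0" "1 \<le> l" for x l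
    unfolding kernel_seq_def using that by (intro Bochner_Integration.integral_cong refl on_fibre)
  define J where "J l x = integral\<^sup>L (fibre_measure \<nu> x) (truncation l)" for l x
  have limit: "kernel_seq \<psi> \<mu> \<nu> w \<phi> x \<longlonglongrightarrow> J L x" if "x \<noteq> 0" "m \<le> L" "absF x < q ^ L" for x L
  proof (rule tendsto_eventually)
    have "kernel_seq \<psi> \<mu> \<nu> w \<phi> x l = J L x" if "L \<le> l" for l
      using truncated_integral_stable[OF assms(6) \<open>x \<noteq> 0\<close> \<open>m \<le> L\<close> \<open>absF x < q ^ L\<close> that]
        kernel[OF \<open>x \<noteq> 0\<close>, of l] m(1) \<open>m \<le> L\<close> that by (simp add: J_def)
    then show "eventually (\<lambda>l. kernel_seq \<psi> \<mu> \<nu> w \<phi> x l = J L x) sequentially"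
      unfolding eventually_sequentially by blast
  qed
  have level: "\<exists>L. m \<le> L \<and> absF x < q ^ L" for x
  proof -
    obtain L where "absF x < q ^ L" using real_arch_pow[OF q_gt_1] by blast
    moreover have "q ^ L \<le> q ^ max m L" using q_gt_1 by (intro power_increasing) auto
    ultimately show ?thesis by (intro exI[of _ "max m L"]) auto
  qed
  show ?thesis
  proof (intro conjI allI impI ballI)
    fix l :: nat and g :: "'F ^ 'n ^ 'n" assume "1 \<le> l" "g \<in> GL"
    then show "integrable (GL_measure \<mu>) (\<lambda>h. Phi_GJ \<psi> h * inv_pullback (c_fun \<mu> w l) (matrix_inv h ** g))"
      by (intro convolution_integrable[OF haar unramified_character_axioms])
  next
    fix x :: 'F and l :: nat assume "x \<noteq> 0" "1 \<le> l"
    then show "integrable (fibre_measure \<nu> x) (kernel_integrand \<psi> \<mu> w \<phi> l)"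
      using truncation_integrable[OF assms(6), of x l] on_fibre
      by (subst Bochner_Integration.integrable_cong[of _ _ _ "truncation l"]) auto
  next
    fix x :: 'F assume "x \<noteq> 0"
    then show "convergent (kernel_seq \<psi> \<mu> \<nu> w \<phi> x)"
      using level[of x] limit convergentI by blast
  next
    show "smooth_on (- {0}) (pi_kernel \<psi> \<mu> \<nu> w \<phi>)"
      unfolding smooth_on_def
    proof
      fix x :: 'F assume "x \<in> - {0}"
      then have x: "x \<noteq> 0" by simp
      obtain L where L: "m \<le> L" "absF x < q ^ L" using level by blast
      \<comment> \<open>On this ball \<open>\<bar>y\<bar> = \<bar>x\<bar>\<close>, so the sequence at \<open>y\<close> is constant from the same index \<open>L\<close> on, and \<open>y/x\<close> lies in \<open>1 + \<pp>\<^sup>L\<close>.\<close>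
      let ?U = "ball x (absF x * absF w ^ L)"
      have "pi_kernel \<psi> \<mu> \<nu> w \<phi> y = J L x" if "y \<in> ?U" for y
      proof -
        have d: "absF (y - x) < absF x * absF w ^ L" using that by (simp add: dist_commute flip: dist_absF)
        also have "\<dots> \<le> absF x" using absF_w by (simp add: mult_left_le power_le_one)
        finally have y: "absF y = absF x" using absF_add_eq[of "y - x" x] by simp
        then have y0: "y \<noteq> 0" using x by (metis absF_eq_0_iff)
        have "y / x - 1 = (y - x) / x" using x by (simp add: field_simps)
        then have "absF (y / x - 1) = absF (y - x) / absF x" by (simp only: absF_divide)
        also have "\<dots> \<le> absF w ^ L" using d x by (simp add: pos_divide_le_eq mult.commute)
        finally have "J L (x * (y / x)) = J L x"
          unfolding J_def by (rule truncated_integral_locally_constant[OF assms(6) x L(1)])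
        then have "J L y = J L x" using x by simp
        moreover have "kernel_seq \<psi> \<mu> \<nu> w \<phi> y \<longlonglongrightarrow> J L y" using limit[OF y0 L(1)] L(2) y by simp
        ultimately show ?thesis unfolding pi_kernel_def by (simp add: limI)
      qed
      then have "pi_kernel \<psi> \<mu> \<nu> w \<phi> constant_on (?U \<inter> - {0})" by (auto simp: constant_on_def)
      moreover have "open ?U" "x \<in> ?U" using x absF_w by auto
      ultimately show "\<exists>U. open U \<and> x \<in> U \<and> pi_kernel \<psi> \<mu> \<nu> w \<phi> constant_on (U \<inter> - {0})" by blast
    qed
  qed
qed

end
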